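(* For every integer $n > 2$ there is no distinct covering system all of whose moduli lie in the interval $[n, 6n]$. Equivalently, $k(n) > 6n$ for every integer $n>2$ for which $k(n)$ is defined.
   Context: A covering system (covering) is a finite set of congruences $\{x \equiv r_i \pmod{n_i} : i=1,\ldots,k\}$ with positive integer moduli $n_i$ such that every integer satisfies at least one of them. A covering is distinct if the moduli $n_i$ are pairwise distinct and all greater than $1$. For an integer $n \ge 2$ such that some distinct covering has all moduli at least $n$, $k(n)$ denotes the least positive integer such that there exists a distinct covering system with all moduli in the interval $[n, k(n)]$. *)

theory Defs
  imports "HOL-Number_Theory.Cong"
begin

text \<open>A pair \<open>(r, m)\<close> stands for the congruence \<open>x \<equiv> r (mod m)\<close>.\<close>

definition covering_system :: "(int \<times> nat) set \<Rightarrow> bool" where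
  "covering_system C \<longleftrightarrow>
     finite C \<and> (\<forall>(r, m)\<in>C. m > 0) \<and>
     (\<forall>x::int. \<exists>(r, m)\<in>C. [x = r] (mod int m))"

definition distinct_covering :: "(int \<times> nat) set \<Rightarrow> bool" where
  "distinct_covering C \<longleftrightarrow>
     covering_system C \<and> inj_on snd C \<and> (\<forall>m\<in>snd ` C. m > 1)"

text \<open>Only meaningful when some distinct covering has all moduli at least \<open>n\<close>;
  otherwise the value of \<open>LEAST\<close> is unspecified.\<close>

definition covering_k :: "nat \<Rightarrow> nat" where
  "covering_k n =
     (LEAST k. k > 0 \<and> (\<exists>C. distinct_covering C \<and> snd ` C \<subseteq> {n..k}))"

end

theory Submission
  imports Defs "HOL-Analysis.Harmonic_Numbers" "HOL-Library.Discrete_Functions"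
begin

text \<open>
  If fewer than \<open>p\<close> moduli are divisible by a power of the prime \<open>p\<close>, these moduli can be dropped
  from a covering. An interval \<open>{n..6 * n}\<close> contains fewer than \<open>p\<close> multiples of \<open>p\<close> as soon as
  \<open>p * (p - 1) > 5 * n\<close>, so only moduli all of whose prime factors are at most about \<open>sqrt (5 * n)\<close>
  remain, and it suffices to show that their reciprocals sum to less than \<open>1\<close>.

  For large \<open>n\<close> write \<open>1 / m = (1 / (m * ln m)) * ln m\<close> and expand \<open>ln m\<close> over the prime powers
  dividing \<open>m\<close>. Since \<open>1 / (x * ln x)\<close> is the derivative of \<open>ln (ln x)\<close>, the sum is essentially at most
  \<open>ln (ln (6 * n) / ln n)\<close> times the sum of \<open>ln p / (p - 1)\<close> over the primes \<open>p \<le> N\<close>, where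
  \<open>N * (N - 1) \<le> 5 * n\<close>. As the latter is \<open>ln N + O(1)\<close> by Mertens, the limit of this bound is
  \<open>ln 6 / 2 < 1\<close>. With explicit constants the argument works for \<open>n \<ge> 681\<close>; smaller \<open>n\<close> are
  settled by computing the sum, after further reductions by prime powers if \<open>n\<close> is \<open>3\<close>, \<open>4\<close>, \<open>5\<close>, \<open>6\<close> or \<open>9\<close>.
\<close>

section \<open>Dropping moduli from a covering\<close>

text \<open>The function \<open>r\<close> attaches one residue class to each modulus, so
  distinctness of the moduli is built in, and discarding congruences means passing to a subset of
  \<open>M\<close>.\<close>

definition coverable :: "nat set \<Rightarrow> bool" where
  "coverable M \<longleftrightarrow> (\<exists>r :: nat \<Rightarrow> int. \<forall>x. \<exists>m\<in>M. int m dvd x - r m)"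

lemma coverable_drop_prime_power:
  assumes cov: "coverable M" and fin: "finite M" and pos: "0 \<notin> M"
    and p: "prime p" and a: "a > 0" and few: "card {m\<in>M. p ^ a dvd m} < p"
  shows "coverable {m\<in>M. \<not> p ^ a dvd m}"
proof -
  obtain r where r: "\<And>x. \<exists>m\<in>M. int m dvd x - r m"
    using cov by (auto simp: coverable_def)
  \<comment> \<open>A shift by \<open>s = W * p ^ (a - 1)\<close> does not affect the moduli that \<open>p ^ a\<close> does not divide, while a
    modulus divisible by \<open>p ^ a\<close> covers at most one of \<open>p\<close> consecutive shifts.\<close>
  define W where "W = (\<Prod>m\<in>M. m div p ^ multiplicity p m)"
  define s where "s = int (W * p ^ (a - 1))"
  have "\<not> p dvd m div p ^ multiplicity p m" if "m \<in> M" for m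
  proof (rule multiplicity_decompose)
    show "m \<noteq> 0" using that pos by metis
    show "\<not> is_unit p" using p by auto
  qed
  then have pW: "\<not> p dvd W"
    unfolding W_def using fin p by (simp add: prime_dvd_prod_iff)
  have dvd_s: "int m dvd s" if m: "m \<in> M" "\<not> p ^ a dvd m" for m
  proof -
    have "multiplicity p m < a"
      using m(2) multiplicity_dvd' not_less by blast
    then have "p ^ multiplicity p m dvd p ^ (a - 1)"
      by (intro le_imp_power_dvd) simp
    moreover have "m div p ^ multiplicity p m dvd W"
      unfolding W_def using fin m(1) by (rule dvd_prodI)
    ultimately have "(m div p ^ multiplicity p m) * p ^ multiplicity p m dvd W * p ^ (a - 1)"
      by (rule mult_dvd_mono[rotated])
    then have "m dvd W * p ^ (a - 1)" by (simp add: multiplicity_dvd)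
    then show ?thesis unfolding s_def by (simp only: of_nat_dvd_iff)
  qed
  have "\<exists>m\<in>{m\<in>M. \<not> p ^ a dvd m}. int m dvd x - r m" for x
  proof (rule ccontr)
    assume uncov: "\<not> ?thesis"
    \<comment> \<open>Shifting the uncovered \<open>x\<close> by multiples of \<open>s\<close> keeps
      it uncovered by the moduli that \<open>p ^ a\<close> does not divide, so every shift needs one
      of the other moduli.\<close>
    have "\<exists>m\<in>M. p ^ a dvd m \<and> int m dvd (x + int t * s) - r m" for t
    proof -
      obtain m where m: "m \<in> M" "int m dvd (x + int t * s) - r m"
        using r by blast
      have "p ^ a dvd m"
      proof (rule ccontr)
        assume n: "\<not> p ^ a dvd m"
        have "int m dvd (x + int t * s) - r m - int t * s"
          using m(2) dvd_s[OF m(1) n] by (meson dvd_diff dvd_mult)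
        then have "int m dvd x - r m" by (simp add: algebra_simps)
        with uncov m(1) n show False by blast
      qed
      with m show ?thesis by blast
    qed
    then obtain f where f: "\<And>t. f t \<in> M \<and> p ^ a dvd f t \<and> int (f t) dvd (x + int t * s) - r (f t)"
      by metis
    \<comment> \<open>Pigeonhole on \<open>p\<close> shifts and fewer than \<open>p\<close> moduli.
      A modulus serving both \<open>t\<close> and \<open>u\<close> will force \<open>p\<close> to
      divide \<open>u - t\<close>, although \<open>0 < u - t < p\<close>.\<close>
    have "\<not> inj_on f {..<p}"
    proof
      assume "inj_on f {..<p}"
      moreover have "f ` {..<p} \<subseteq> {m\<in>M. p ^ a dvd m}" using f by blast
      ultimately have "card {..<p} \<le> card {m\<in>M. p ^ a dvd m}"
        using fin by (intro card_inj_on_le) auto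
      with few show False by simp
    qed
    then obtain t u where tu: "t < p" "u < p" "t < u" "f t = f u"
      unfolding inj_on_def by (metis lessThan_iff linorder_neqE_nat)
    have "int (f t) dvd ((x + int u * s) - r (f u)) - ((x + int t * s) - r (f t))"
      using f[of t] f[of u] tu(4) by (metis dvd_diff)
    then have "int (f t) dvd int (u - t) * s"
      using tu by (simp add: algebra_simps of_nat_diff)
    then have "f t dvd (u - t) * (W * p ^ (a - 1))"
      unfolding s_def by (metis of_nat_dvd_iff of_nat_mult)
    then have "p ^ a dvd (u - t) * (W * p ^ (a - 1))"
      using f dvd_trans by blast
    moreover have "p ^ a = p * p ^ (a - 1)"
      using a by (metis power_eq_if not_gr_zero)
    ultimately have "p dvd (u - t) * W"
      using p by (simp add: mult.assoc[symmetric] prime_gt_0_nat)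
    then have "p dvd u - t" using p pW by (simp add: prime_dvd_mult_iff)
    with tu show False by (meson diff_le_self dvd_imp_le leD order_le_less_trans zero_less_diff)
  qed
  then show ?thesis by (auto simp: coverable_def)
qed

section \<open>Density of residue classes\<close>

lemma card_residue_class_le:
  fixes m k :: nat and r :: int
  assumes "m > 0"
  shows "card {x\<in>{0..<int (m * k)}. int m dvd x - r} \<le> k"
proof -
  have "inj_on (\<lambda>x. x div int m) {x\<in>{0..<int (m * k)}. int m dvd x - r}"
  proof (rule inj_onI)
    fix x y assume *: "x \<in> {x\<in>{0..<int (m * k)}. int m dvd x - r}"
      "y \<in> {x\<in>{0..<int (m * k)}. int m dvd x - r}" "x div int m = y div int m"
    then have "x mod int m = y mod int m" by (auto simp: mod_eq_dvd_iff[symmetric])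
    with *(3) show "x = y" by (metis div_mult_mod_eq)
  qed
  moreover have "(\<lambda>x. x div int m) ` {x\<in>{0..<int (m * k)}. int m dvd x - r} \<subseteq> {0..<int k}"
  proof clarsimp
    fix x :: int
    assume x: "0 \<le> x" "x < int m * int k"
    have "int m * (x div int m) \<le> x"
      using assms by (simp add: minus_mod_eq_mult_div[symmetric])
    with x(2) have "int m * (x div int m) < int m * int k" by linarith
    with x(1) assms show "0 \<le> x div int m \<and> x div int m < int k"
      by (simp add: pos_imp_zdiv_nonneg_iff)
  qed
  ultimately have "card {x\<in>{0..<int (m * k)}. int m dvd x - r} \<le> card {0..<int k}"
    by (intro card_inj_on_le) auto
  then show ?thesis by simp
qed

text \<open>Count over one common period \<open>L\<close>: the class of modulus \<open>m\<close>
  contains at most \<open>L div m\<close> of the \<open>L\<close> integers in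
  \<open>{0..<L}\<close>, and together the classes must reach all of them.\<close>

lemma coverable_imp_sum_ge_1:
  assumes cov: "coverable M" and fin: "finite M" and pos: "0 \<notin> M"
  shows "(\<Sum>m\<in>M. 1 / real m) \<ge> 1"
proof -
  obtain r where r: "\<And>x. \<exists>m\<in>M. int m dvd x - r m"
    using cov by (auto simp: coverable_def)
  define L where "L = \<Prod>M"
  have L: "L > 0" using fin pos by (auto simp: L_def prod_pos_nat_iff intro!: prod_pos gr0I)
  have dvdL: "m dvd L" if "m \<in> M" for m unfolding L_def using fin that by (rule dvd_prodI)
  have "{0..<int L} = (\<Union>m\<in>M. {x\<in>{0..<int L}. int m dvd x - r m})" using r by blast
  then have "L \<le> card (\<Union>m\<in>M. {x\<in>{0..<int L}. int m dvd x - r m})"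
    by (metis card_atLeastLessThan_int diff_zero nat_int order_refl)
  also have "\<dots> \<le> (\<Sum>m\<in>M. card {x\<in>{0..<int L}. int m dvd x - r m})"
    using fin by (rule card_UN_le)
  also have "\<dots> \<le> (\<Sum>m\<in>M. L div m)"
  proof (rule sum_mono)
    fix m assume m: "m \<in> M"
    with pos have "m > 0" by (metis gr0I)
    from card_residue_class_le[OF this, of "L div m" "r m"] dvdL[OF m]
    show "card {x\<in>{0..<int L}. int m dvd x - r m} \<le> L div m" by simp
  qed
  finally have "real L \<le> (\<Sum>m\<in>M. real (L div m))" by (metis of_nat_le_iff of_nat_sum)
  also have "\<dots> = (\<Sum>m\<in>M. real L * (1 / real m))"
    using dvdL by (intro sum.cong) (auto simp: real_of_nat_div)
  finally have "real L * 1 \<le> real L * (\<Sum>m\<in>M. 1 / real m)" by (simp add: sum_distrib_left)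
  then show ?thesis using L by (simp only: mult_le_cancel_left_pos of_nat_0_less_iff)
qed

section \<open>Multiples in an interval and removal of large primes\<close>

text \<open>The lower end \<open>(a + q - 1) div q\<close> is \<open>a / q\<close> rounded
  up.\<close>

lemma multiples_eq_image:
  fixes q a b :: nat
  assumes "q > 0"
  shows "{m\<in>{a..b}. q dvd m} = (*) q ` {(a + q - 1) div q..b div q}"
proof -
  have "a \<le> q * k \<longleftrightarrow> (a + q - 1) div q \<le> k" for k
  proof -
    have "(a + q - 1) div q \<le> k \<longleftrightarrow> a + q - 1 < (k + 1) * q"
      using assms by (metis Suc_eq_plus1 div_less_iff_less_mult less_Suc_eq_le)
    then show ?thesis using assms by (auto simp: algebra_simps)
  qed
  moreover have "q * k \<le> b \<longleftrightarrow> k \<le> b div q" for k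
    using assms by (simp add: less_eq_div_iff_mult_less_eq mult.commute)
  ultimately show ?thesis by (auto elim!: dvdE)
qed

text \<open>Among \<open>p\<close> or more multiples of \<open>p\<close>, the extreme ones differ by
  at least \<open>p * (p - 1)\<close>, which exceeds the length \<open>5 * n\<close> of the
  interval.\<close>

lemma card_multiples_less_prime:
  fixes n p :: nat
  assumes "p * (p - 1) > 5 * n"
  shows "card {m\<in>{n..6 * n}. p dvd m} < p"
proof (rule ccontr)
  define k0 where "k0 = (n + p - 1) div p"
  define k1 where "k1 = 6 * n div p"
  assume contra: "\<not> ?thesis"
  have p: "p > 0" using assms by (cases p) auto
  have "card {m\<in>{n..6 * n}. p dvd m} = k1 + 1 - k0"
    unfolding multiples_eq_image[OF p] k0_def[symmetric] k1_def[symmetric]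
    using p by (subst card_image) (auto simp: inj_on_def)
  with contra p have k: "k0 + (p - 1) \<le> k1" by linarith
  then have k0: "p * k0 \<in> (*) p ` {k0..k1}" and k1: "p * k1 \<in> (*) p ` {k0..k1}" by auto
  have "n \<le> p * k0" "p * k1 \<le> 6 * n"
    using k0 k1 unfolding k0_def k1_def multiples_eq_image[OF p, symmetric] by auto
  moreover have "p * (k0 + (p - 1)) \<le> p * k1" using k by (rule mult_le_mono2)
  ultimately have "p * (p - 1) \<le> 5 * n" unfolding distrib_left by linarith
  with assms show False by simp
qed

lemma coverable_interval_smooth:
  fixes n :: nat
  assumes "coverable {n..6 * n}" and "n > 0"
  shows "coverable {m\<in>{n..6 * n}. \<forall>p. prime p \<longrightarrow> p dvd m \<longrightarrow> p * (p - 1) \<le> 5 * n}"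
proof -
  \<comment> \<open>Primes are removed one at a time. The bound on the number of multiples in the
    full interval passes to whatever subset earlier removals have left.\<close>
  have *: "coverable {m\<in>{n..6 * n}. \<forall>p\<in>Q. \<not> p dvd m}"
    if "finite Q" "\<And>p. p \<in> Q \<Longrightarrow> prime p \<and> p * (p - 1) > 5 * n" for Q
    using that
  proof (induction Q rule: finite_induct)
    case empty
    have "{m\<in>{n..6 * n}. \<forall>p\<in>{}. \<not> p dvd m} = {n..6 * n}" by auto
    then show ?case using assms(1) by (simp only:)
  next
    case (insert p Q)
    let ?M = "{m\<in>{n..6 * n}. \<forall>p\<in>Q. \<not> p dvd m}"
    have "card {m\<in>?M. p ^ 1 dvd m} \<le> card {m\<in>{n..6 * n}. p dvd m}"
      by (intro card_mono) auto
    also have "\<dots> < p" using insert.prems by (intro card_multiples_less_prime) auto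
    finally have "coverable {m\<in>?M. \<not> p ^ 1 dvd m}"
      using insert assms(2) by (intro coverable_drop_prime_power) auto
    moreover have "{m\<in>?M. \<not> p ^ 1 dvd m} = {m\<in>{n..6 * n}. \<forall>p\<in>insert p Q. \<not> p dvd m}"
      by auto
    ultimately show ?case by simp
  qed
  \<comment> \<open>The bound \<open>p \<le> 6 * n\<close> makes \<open>Q\<close> finite and loses
    nothing, as a larger prime divides no number of the interval.\<close>
  define Q where "Q = {p. prime p \<and> p \<le> 6 * n \<and> p * (p - 1) > 5 * n}"
  have "{m\<in>{n..6 * n}. \<forall>p\<in>Q. \<not> p dvd m} =
      {m\<in>{n..6 * n}. \<forall>p. prime p \<longrightarrow> p dvd m \<longrightarrow> p * (p - 1) \<le> 5 * n}"
  proof -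
    have "p \<le> 6 * n" if "m \<in> {n..6 * n}" "p dvd m" for p m
    proof -
      have "m > 0" "m \<le> 6 * n" using that(1) assms(2) by auto
      with dvd_imp_le[OF that(2)] show ?thesis by linarith
    qed
    then show ?thesis unfolding Q_def not_less[symmetric] by blast
  qed
  moreover have "finite Q" by (rule finite_subset[of _ "{..6 * n}"]) (auto simp: Q_def)
  moreover have "prime p \<and> p * (p - 1) > 5 * n" if "p \<in> Q" for p
    using that unfolding Q_def by blast
  ultimately show ?thesis using *[of Q] by metis
qed

section \<open>Reciprocals of smooth numbers\<close>

text \<open>The identity \<open>ln m = (sum of ln p over prime powers p ^ a dividing m)\<close>,
  written with index ranges independent of \<open>m\<close> so that sums over \<open>m\<close> can
  be exchanged with it. Exponents up to \<open>J\<close> suffice because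
  \<open>multiplicity p m < m\<close>.\<close>

lemma ln_eq_sum_prime_powers:
  fixes m :: nat
  assumes "m > 0" "m \<le> J" "finite P" "\<And>p. p \<in> P \<Longrightarrow> prime p"
    and P: "\<And>p. prime p \<Longrightarrow> p dvd m \<Longrightarrow> p \<in> P"
  shows "ln (real m) = (\<Sum>p\<in>P. \<Sum>a=1..J. if p ^ a dvd m then ln (real p) else 0)"
proof -
  have mult: "(\<Sum>a=1..J. if p ^ a dvd m then ln (real p) else 0) = multiplicity p m * ln (real p)"
    if "prime p" for p
  proof -
    have "multiplicity p m < m"
    proof -
      have "p ^ multiplicity p m \<le> m" using assms(1) multiplicity_dvd by (intro dvd_imp_le) auto
      moreover have "2 ^ multiplicity p m \<le> p ^ multiplicity p m"
        using prime_ge_2_nat[OF that] by (intro power_mono) auto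
      moreover have "multiplicity p m < 2 ^ multiplicity p m" by simp
      ultimately show ?thesis by linarith
    qed
    moreover have "p ^ a dvd m \<longleftrightarrow> a \<le> multiplicity p m" for a
      using assms(1) that by (intro power_dvd_iff_le_multiplicity) auto
    ultimately have "{a\<in>{1..J}. p ^ a dvd m} = {1..multiplicity p m}"
      using assms(2) by (intro set_eqI) (simp, linarith)
    then show ?thesis by (simp flip: sum.inter_filter)
  qed
  have "ln (real m) = ln (\<Prod>p\<in>prime_factors m. real p ^ multiplicity p m)"
    using prime_factorization_nat[OF assms(1)] by (metis (no_types, lifting) of_nat_power of_nat_prod prod.cong)
  also have "\<dots> = (\<Sum>p\<in>prime_factors m. ln (real p ^ multiplicity p m))"
    by (intro ln_prod) (auto simp: prime_factors_gt_0_nat)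
  also have "\<dots> = (\<Sum>p\<in>prime_factors m. multiplicity p m * ln (real p))"
    by (intro sum.cong) (auto simp: ln_realpow prime_factors_gt_0_nat)
  also have "\<dots> = (\<Sum>p\<in>P. multiplicity p m * ln (real p))"
    using assms(1,3,4) P
    by (intro sum.mono_neutral_left) (auto simp: in_prime_factors_iff not_dvd_imp_multiplicity_0)
  also have "\<dots> = (\<Sum>p\<in>P. \<Sum>a=1..J. if p ^ a dvd m then ln (real p) else 0)"
    using assms(4) mult by (intro sum.cong) auto
  finally show ?thesis .
qed

text \<open>The decreasing function \<open>1 / (t * ln t)\<close> is compared with its integral from
  \<open>x\<close> to \<open>y\<close>. The proof applies \<open>ln u \<le> u - 1\<close> twice, to
  \<open>x / y\<close> and to \<open>ln x / ln y\<close>.\<close>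

lemma inverse_mult_ln_le_ln_ln_diff:
  fixes x y :: real
  assumes "1 < x" "x \<le> y"
  shows "(y - x) / (y * ln y) \<le> ln (ln y) - ln (ln x)"
proof -
  have pos: "0 < ln x" "ln x \<le> ln y" using assms by auto
  have "(y - x) / y \<le> ln y - ln x"
  proof -
    have "ln (x / y) \<le> x / y - 1" using assms by (intro ln_le_minus_one) auto
    then show ?thesis using assms by (simp add: ln_div field_simps)
  qed
  then have "(y - x) / y / ln y \<le> (ln y - ln x) / ln y"
    using pos by (intro divide_right_mono) auto
  also have "\<dots> = - (ln x / ln y - 1)" using pos by (simp add: field_simps)
  also have "\<dots> \<le> - ln (ln x / ln y)"
    using pos ln_le_minus_one[of "ln x / ln y"] by auto
  also have "\<dots> = ln (ln y) - ln (ln x)" using pos by (simp add: ln_div)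
  finally show ?thesis by (simp add: field_simps)
qed

text \<open>The first multiple is paid for by \<open>1 / (n * ln n)\<close>. Every later one is
  bounded by the integral over the preceding gap of length \<open>q\<close>, and these integrals
  telescope.\<close>

lemma sum_multiples_inverse_mult_ln_le:
  fixes n q b :: nat
  assumes "n \<ge> 2" "q > 0" "n \<le> b"
  shows "(\<Sum>m | m \<in> {n..b} \<and> q dvd m. 1 / (real m * ln (real m)))
    \<le> 1 / (real n * ln (real n)) + (ln (ln (real b)) - ln (ln (real n))) / real q"
proof -
  define k0 where "k0 = (n + q - 1) div q"
  have img: "{m. m \<in> {n..b} \<and> q dvd m} = (*) q ` {k0..b div q}"
    unfolding k0_def using multiples_eq_image[OF assms(2)] by simp
  have lnmono: "ln (ln (real x)) \<le> ln (ln (real y))" if "2 \<le> x" "x \<le> y" for x y :: nat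
    using that by simp
  show ?thesis
  proof (cases "k0 \<le> b div q")
    case False
    have "ln (ln (real n)) \<le> ln (ln (real b))" using lnmono assms by blast
    then show ?thesis unfolding img using False assms by simp
  next
    case True
    then have "q * k0 \<in> (*) q ` {k0..b div q}" "q * (b div q) \<in> (*) q ` {k0..b div q}" by auto
    then have k0: "n \<le> q * k0" and k1: "q * (b div q) \<le> b"
      unfolding img[symmetric] by auto
    have "(\<Sum>k=k0..k. 1 / (real (q * k) * ln (real (q * k))))
        \<le> 1 / (real n * ln (real n)) + (ln (ln (real (q * k))) - ln (ln (real (q * k0)))) / real q"
      if "k0 \<le> k" for k
      using that
    proof (induction k rule: dec_induct)
      case base
      have "real n \<le> real (q * k0)" using k0 by (simp only: of_nat_le_iff)
      then have "real n * ln (real n) \<le> real (q * k0) * ln (real (q * k0))"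
        using assms(1) by (intro mult_mono) auto
      then show ?case using assms(1) by (simp add: frac_le)
    next
      case (step k)
      have x: "real (q * k) > 1" using k0 step(1) assms(1)
        by (smt (verit) mult_le_mono2 of_nat_le_iff of_nat_1 of_nat_less_iff order_trans one_less_numeral_iff semiring_norm(76) of_nat_numeral)
      have "1 / (real (q * Suc k) * ln (real (q * Suc k))) =
          (real (q * Suc k) - real (q * k)) / (real (q * Suc k) * ln (real (q * Suc k))) / real q"
        using assms(2) by (simp add: of_nat_mult distrib_left)
      also have "\<dots> \<le> (ln (ln (real (q * Suc k))) - ln (ln (real (q * k)))) / real q"
        using x by (intro divide_right_mono inverse_mult_ln_le_ln_ln_diff) auto
      finally show ?case using step(3) step(1)
        by (simp add: diff_divide_distrib del: of_nat_mult mult_Suc_right)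
    qed
    from this[OF True]
    have "(\<Sum>k=k0..b div q. 1 / (real (q * k) * ln (real (q * k))))
        \<le> 1 / (real n * ln (real n)) + (ln (ln (real (q * (b div q)))) - ln (ln (real (q * k0)))) / real q" .
    also have "\<dots> \<le> 1 / (real n * ln (real n)) + (ln (ln (real b)) - ln (ln (real n))) / real q"
    proof -
      have "q * k0 \<le> q * (b div q)" using True by simp
      then have "2 \<le> q * (b div q)" using k0 assms(1) by linarith
      then have "ln (ln (real (q * (b div q)))) \<le> ln (ln (real b))"
        using k1 by (rule lnmono)
      moreover have "ln (ln (real n)) \<le> ln (ln (real (q * k0)))"
        using assms(1) k0 by (rule lnmono)
      ultimately have "ln (ln (real (q * (b div q)))) - ln (ln (real (q * k0))) \<le> ln (ln (real b)) - ln (ln (real n))"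
        by (rule diff_mono)
      then show ?thesis by (intro add_left_mono divide_right_mono) auto
    qed
    finally show ?thesis unfolding img using assms(2)
      by (subst sum.reindex) (auto simp: inj_on_def o_def)
  qed
qed

lemma sum_inverse_powers:
  fixes x :: real
  assumes "x > 1"
  shows "(\<Sum>a=1..e. 1 / x ^ a) = (1 - 1 / x ^ e) / (x - 1)"
proof (induction e)
  case (Suc e)
  have "(1 - 1 / x ^ e) / (x - 1) + 1 / x ^ Suc e = (1 - 1 / x ^ Suc e) / (x - 1)"
    using assms by (simp add: field_simps)
  with Suc show ?case by simp
qed simp

text \<open>After the exchange of sums, the multiples of \<open>p ^ a\<close> contribute at most
  \<open>ln p * (E + D / p ^ a)\<close>. The parts with \<open>D\<close> form a geometric series.
  The error \<open>E * ln p\<close> occurs once for each exponent with \<open>p ^ a \<le> b\<close>,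
  hence costs at most \<open>E * ln b\<close> per prime.\<close>

lemma sum_inverse_smooth_le:
  fixes n b :: nat
  assumes n: "n \<ge> 2" "n \<le> b" and S: "S \<subseteq> {n..b}"
    and P: "finite P" "\<And>p. p \<in> P \<Longrightarrow> prime p"
    and smooth: "\<And>m p. m \<in> S \<Longrightarrow> prime p \<Longrightarrow> p dvd m \<Longrightarrow> p \<in> P"
  shows "(\<Sum>m\<in>S. 1 / real m) \<le> (ln (ln b) - ln (ln n)) * (\<Sum>p\<in>P. ln (real p) / (real p - 1))
    + real (card P) * ln b / (n * ln n)"
proof -
  define D where "D = ln (ln (real b)) - ln (ln (real n))"
  define w where "w = (\<lambda>m::nat. 1 / (real m * ln (real m)))"
  define E where "E = 1 / (real n * ln (real n))"
  have fin: "finite S" using S finite_subset by blast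
  have D: "D \<ge> 0" unfolding D_def using n by simp
  have E: "E \<ge> 0" unfolding E_def using n by simp
  have w: "w m \<ge> 0" for m unfolding w_def by (cases m) auto
  have "(\<Sum>m\<in>S. 1 / real m) =
      (\<Sum>m\<in>S. \<Sum>p\<in>P. \<Sum>a=1..b. if p ^ a dvd m then ln (real p) * w m else 0)"
  proof (rule sum.cong)
    fix m assume m: "m \<in> S"
    then have mb: "2 \<le> m" "m \<le> b" using S n by auto
    have "1 / real m = w m * ln (real m)" using mb by (simp add: w_def)
    also have "ln (real m) = (\<Sum>p\<in>P. \<Sum>a=1..b. if p ^ a dvd m then ln (real p) else 0)"
      using mb P smooth[OF m] by (intro ln_eq_sum_prime_powers) auto
    finally show "1 / real m = (\<Sum>p\<in>P. \<Sum>a=1..b. if p ^ a dvd m then ln (real p) * w m else 0)"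
      by (simp add: sum_distrib_left if_distrib mult.commute cong: if_cong)
  qed simp
  also have "\<dots> = (\<Sum>p\<in>P. \<Sum>a=1..b. \<Sum>m\<in>S. if p ^ a dvd m then ln (real p) * w m else 0)"
    unfolding sum.swap[of _ P S] sum.swap[of _ _ S] by (rule refl)
  also have "\<dots> \<le> (\<Sum>p\<in>P. D * (ln (real p) / (real p - 1)) + ln (real b) * E)"
  proof (rule sum_mono)
    fix p assume "p \<in> P"
    then have p: "p \<ge> 2" using P prime_ge_2_nat by blast
    have lnp: "ln (real p) \<ge> 0" using p by simp
    \<comment> \<open>The largest exponent with \<open>p ^ e \<le> b\<close>; higher powers of
      \<open>p\<close> divide no element of \<open>S\<close>.\<close>
    define e where "e = nat \<lfloor>log p b\<rfloor>"
    have le_e: "p ^ a \<le> b \<longleftrightarrow> a \<le> e" for a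
    proof -
      have "p ^ a \<le> b \<longleftrightarrow> real p ^ a \<le> real b" by (metis of_nat_le_iff of_nat_power)
      also have "\<dots> \<longleftrightarrow> real a \<le> log p b" using p n by (subst le_log_iff) (auto simp: powr_realpow)
      also have "\<dots> \<longleftrightarrow> a \<le> e" unfolding e_def
        using p n by (subst le_nat_iff) (auto simp: le_floor_iff)
      finally show ?thesis .
    qed
    have e: "real e * ln (real p) \<le> ln (real b)"
    proof -
      have "p ^ e \<le> b" using le_e by simp
      then have "real p ^ e \<le> real b" by (metis of_nat_le_iff of_nat_power)
      then have "ln (real p ^ e) \<le> ln (real b)" using p n by (subst ln_le_cancel_iff) auto
      then show ?thesis using p by (simp add: ln_realpow)
    qed
    have "(\<Sum>a=1..b. \<Sum>m\<in>S. if p ^ a dvd m then ln (real p) * w m else 0)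
        \<le> (\<Sum>a=1..b. if a \<le> e then ln (real p) * (E + D / real p ^ a) else 0)"
    proof (rule sum_mono)
      fix a
      have "(\<Sum>m\<in>S. if p ^ a dvd m then ln (real p) * w m else 0) =
          ln (real p) * (\<Sum>m | m \<in> S \<and> p ^ a dvd m. w m)"
        using fin by (simp add: sum_distrib_left flip: sum.inter_filter)
      also have "\<dots> \<le> (if a \<le> e then ln (real p) * (E + D / real p ^ a) else 0)"
      proof (cases "a \<le> e")
        case True
        have "(\<Sum>m | m \<in> S \<and> p ^ a dvd m. w m) \<le> (\<Sum>m | m \<in> {n..b} \<and> p ^ a dvd m. w m)"
          using S w by (intro sum_mono2) auto
        also have "\<dots> \<le> E + D / real (p ^ a)"
          unfolding w_def E_def D_def using n p by (intro sum_multiples_inverse_mult_ln_le) auto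
        finally show ?thesis using True lnp by (simp add: mult_left_mono)
      next
        case False
        have "{m. m \<in> S \<and> p ^ a dvd m} = {}"
        proof -
          have "p ^ a > b" using False le_e not_less by blast
          moreover have "p ^ a \<le> b" if "m \<in> S" "p ^ a dvd m" for m
          proof -
            have "0 < m" "m \<le> b" using that(1) S n by auto
            with dvd_imp_le[OF that(2)] show ?thesis by linarith
          qed
          ultimately show ?thesis by (auto simp: not_less[symmetric])
        qed
        then show ?thesis using False by (simp only:) simp
      qed
      finally show "(\<Sum>m\<in>S. if p ^ a dvd m then ln (real p) * w m else 0)
        \<le> (if a \<le> e then ln (real p) * (E + D / real p ^ a) else 0)" .
    qed
    also have "\<dots> = (\<Sum>a\<in>{a \<in> {1..b}. a \<le> e}. ln (real p) * (E + D / real p ^ a))"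
      by (rule sum.inter_filter[symmetric]) simp
    also have "\<dots> \<le> (\<Sum>a=1..e. ln (real p) * (E + D / real p ^ a))"
      using D E lnp by (intro sum_mono2) auto
    also have "\<dots> = E * (real e * ln (real p)) + D * ln (real p) * (\<Sum>a=1..e. 1 / real p ^ a)"
      by (simp add: algebra_simps sum.distrib sum_distrib_left)
    also have "\<dots> \<le> E * ln (real b) + D * ln (real p) * (1 / (real p - 1))"
    proof -
      have "(\<Sum>a=1..e. 1 / real p ^ a) = (1 - 1 / real p ^ e) / (real p - 1)"
        by (rule sum_inverse_powers) (use p in simp)
      also have "\<dots> \<le> 1 / (real p - 1)" using p by (intro divide_right_mono) auto
      finally show ?thesis using e D E lnp by (intro add_mono mult_left_mono) auto
    qed
    finally show "(\<Sum>a=1..b. \<Sum>m\<in>S. if p ^ a dvd m then ln (real p) * w m else 0)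
        \<le> D * (ln (real p) / (real p - 1)) + ln (real b) * E" by (simp add: mult.commute)
  qed
  also have "\<dots> = D * (\<Sum>p\<in>P. ln (real p) / (real p - 1)) + real (card P) * ln b / (n * ln n)"
    by (simp add: sum.distrib sum_distrib_left E_def)
  finally show ?thesis unfolding D_def .
qed

section \<open>A Mertens estimate\<close>

definition primes_upto :: "nat \<Rightarrow> nat set" where
  "primes_upto n = {p. prime p \<and> p \<le> n}"

definition theta :: "nat \<Rightarrow> real" where
  "theta n = (\<Sum>p\<in>primes_upto n. ln (real p))"

lemma finite_primes_upto [simp]: "finite (primes_upto n)"
  by (rule finite_subset[of _ "{..n}"]) (auto simp: primes_upto_def)

lemma primes_upto_Suc:
  "primes_upto (Suc n) = (if prime (Suc n) then insert (Suc n) (primes_upto n) else primes_upto n)"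
  by (auto simp: primes_upto_def le_Suc_eq)

section \<open>Chebyshev's bound for \<open>theta\<close>\<close>

lemma prod_primes_dvd:
  fixes x :: nat
  assumes "finite F" "\<And>p. p \<in> F \<Longrightarrow> prime p \<and> p dvd x"
  shows "\<Prod>F dvd x"
  using assms
proof (induction F rule: finite_induct)
  case (insert p F)
  have "coprime p (\<Prod>F)"
    using insert by (intro prod_coprime_right) (metis insertCI primes_coprime)
  with insert show ?case by (simp add: divides_mult)
qed simp

text \<open>The two equal middle coefficients together are at most the row sum
  \<open>2 ^ (2 * m + 1)\<close>.\<close>

lemma binomial_odd_le_four_power: "(2 * m + 1) choose m \<le> 4 ^ m"
proof -
  have eq: "(2 * m + 1) choose Suc m = (2 * m + 1) choose m"
    using central_binomial_odd[of "2 * m + 1"] by simp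
  have "(\<Sum>k\<in>{m, Suc m}. (2 * m + 1) choose k) \<le> (\<Sum>k\<le>2 * m + 1. (2 * m + 1) choose k)"
    by (intro sum_mono2) auto
  also have "\<dots> = 2 ^ (2 * m + 1)" by (rule choose_row_sum)
  finally show ?thesis using eq by (simp add: power_mult)
qed

text \<open>Erdos's argument: for \<open>n = 2 * m + 1\<close>, the primes in
  \<open>{m + 2..n}\<close> all divide \<open>n choose m\<close>, which is at most
  \<open>4 ^ m\<close>, and those up to \<open>m + 1\<close> are handled by induction. An even
  \<open>n > 2\<close> reduces to \<open>n - 1\<close>.\<close>

lemma prod_primes_upto_le: "\<Prod>(primes_upto n) \<le> 4 ^ n"
proof (induction n rule: less_induct)
  case (less n)
  consider "n < 2" | "n = 2" | "n > 2" "even n" | m where "n = 2 * m + 1" "m \<ge> 1"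
    by (metis One_nat_def Suc_leI gr0I less_2_cases_iff linorder_neqE_nat mult_0_right oddE add_0)
  then show ?case
  proof cases
    case 1
    then have "primes_upto n = {}" by (auto simp: primes_upto_def dest: prime_ge_2_nat)
    then show ?thesis by simp
  next
    case 2
    then have "primes_upto n = {2}" by (auto simp: primes_upto_def dest: prime_ge_2_nat)
    then show ?thesis using 2 by simp
  next
    case 3
    then obtain k where k: "n = Suc k" by (cases n) auto
    have "\<not> prime n" using 3 prime_odd_nat by blast
    then have "primes_upto n = primes_upto k" using k by (simp add: primes_upto_Suc)
    moreover have "\<Prod>(primes_upto k) \<le> 4 ^ k" using less k by simp
    ultimately show ?thesis using k by simp
  next
    case (4 m)
    define Q where "Q = {p. prime p \<and> m + 1 < p \<and> p \<le> 2 * m + 1}"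
    have finQ: "finite Q" by (rule finite_subset[of _ "{..2 * m + 1}"]) (auto simp: Q_def)
    have split: "primes_upto n = primes_upto (m + 1) \<union> Q" "primes_upto (m + 1) \<inter> Q = {}"
      using 4 by (auto simp: primes_upto_def Q_def)
    have "\<Prod>Q dvd (2 * m + 1) choose m"
    proof (rule prod_primes_dvd[OF finQ])
      fix p assume p: "p \<in> Q"
      have "fact m * fact (m + 1) * ((2 * m + 1) choose m) = (fact (2 * m + 1) :: nat)"
        using binomial_fact_lemma[of m "2 * m + 1"] by (simp add: Suc_diff_le numeral_2_eq_2)
      moreover have "p dvd (fact (2 * m + 1) :: nat)" "\<not> p dvd (fact m :: nat)" "\<not> p dvd (fact (m + 1) :: nat)"
        using p prime_dvd_fact_iff[of p] unfolding Q_def by (auto simp del: fact_Suc)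
      ultimately show "prime p \<and> p dvd (2 * m + 1) choose m"
        using p unfolding Q_def by (metis (no_types, lifting) mem_Collect_eq prime_dvd_mult_iff)
    qed
    then have "\<Prod>Q \<le> (2 * m + 1) choose m" by (intro dvd_imp_le) auto
    also have "\<dots> \<le> 4 ^ m" by (rule binomial_odd_le_four_power)
    finally have "\<Prod>Q \<le> 4 ^ m" .
    moreover have "\<Prod>(primes_upto (m + 1)) \<le> 4 ^ (m + 1)" by (rule less) (use 4 in simp)
    ultimately have "\<Prod>(primes_upto (m + 1)) * \<Prod>Q \<le> 4 ^ (m + 1) * 4 ^ m" by (rule mult_le_mono[rotated])
    also have "\<dots> = 4 ^ n" using 4 by (simp flip: power_add)
    finally show ?thesis using split finQ by (simp add: prod.union_disjoint)
  qed
qed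

lemma theta_le: "theta n \<le> real n * ln 4"
proof -
  have "theta n = ln (\<Prod>p\<in>primes_upto n. real p)"
    unfolding theta_def by (rule ln_prod[symmetric]) (auto simp: primes_upto_def dest: prime_gt_0_nat)
  also have "\<dots> = ln (real (\<Prod>(primes_upto n)))" by simp
  also have "\<dots> \<le> ln (real (4 ^ n))"
  proof (subst ln_le_cancel_iff)
    have "0 < \<Prod>(primes_upto n)" by (intro prod_pos) (auto simp: primes_upto_def dest: prime_gt_0_nat)
    then show "0 < real (\<Prod>(primes_upto n))" by (simp only: of_nat_0_less_iff)
    show "real (\<Prod>(primes_upto n)) \<le> real (4 ^ n)" using prod_primes_upto_le by (simp only: of_nat_le_iff)
  qed simp
  also have "\<dots> = real n * ln 4" by (simp add: ln_realpow)
  finally show ?thesis .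
qed

lemma theta_nonneg: "theta n \<ge> 0"
  unfolding theta_def by (intro sum_nonneg) (auto simp: primes_upto_def dest: prime_gt_0_nat)

lemma theta_Suc: "theta (Suc n) = theta n + (if prime (Suc n) then ln (real (Suc n)) else 0)"
proof -
  have "Suc n \<notin> primes_upto n" by (simp add: primes_upto_def)
  then show ?thesis unfolding theta_def primes_upto_Suc by (simp add: add.commute)
qed

section \<open>Partial summation over the primes between \<open>N div 2\<close> and
  \<open>N\<close>\<close>

text \<open>Abel summation: the values \<open>ln p\<close> are the increments of
  \<open>theta\<close>, and \<open>1 / j - 1 / (j + 1) = 1 / (j * (j + 1))\<close>.\<close>

lemma sum_ln_div_prime_by_parts:
  assumes "M \<le> K"
  shows "(\<Sum>p\<in>primes_upto K - primes_upto M. ln (real p) / real p) =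
    theta K / (real K + 1) - theta M / (real M + 1) + (\<Sum>j=Suc M..K. theta j / (real j * (real j + 1)))"
  using assms
proof (induction K rule: dec_induct)
  case (step K)
  have *: "theta (Suc K) / (real (Suc K) + 1) + theta (Suc K) / (real (Suc K) * (real (Suc K) + 1))
      = theta (Suc K) / real (Suc K)"
    by (simp add: divide_simps) (simp add: algebra_simps)
  show ?case
  proof (cases "prime (Suc K)")
    case True
    then have "primes_upto (Suc K) - primes_upto M = insert (Suc K) (primes_upto K - primes_upto M)"
      "Suc K \<notin> primes_upto K - primes_upto M"
      using step(1) by (auto simp: primes_upto_def le_Suc_eq)
    then have "(\<Sum>p\<in>primes_upto (Suc K) - primes_upto M. ln (real p) / real p)
      = ln (real (Suc K)) / real (Suc K) + (\<Sum>p\<in>primes_upto K - primes_upto M. ln (real p) / real p)"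
      by simp
    moreover have "ln (real (Suc K)) / real (Suc K) = theta (Suc K) / real (Suc K) - theta K / (real K + 1)"
      using True by (simp add: theta_Suc diff_divide_distrib[symmetric] add.commute)
    ultimately show ?thesis using step * by simp
  next
    case False
    then have "primes_upto (Suc K) = primes_upto K" "theta (Suc K) = theta K"
      by (simp_all add: primes_upto_Suc theta_Suc)
    then show ?thesis using step * by (simp add: add.commute)
  qed
qed simp

lemma inverse_Suc_le_ln_diff: "n > 0 \<Longrightarrow> 1 / (real n + 1) \<le> ln (real n + 1) - ln (real n)"
  using ln_le_minus_one[of "real n / (real n + 1)"] by (simp add: ln_div field_simps)

lemma sum_inverse_Suc_le:
  assumes "0 < M" "M \<le> K"
  shows "(\<Sum>j=Suc M..K. 1 / (real j + 1)) \<le> ln (real K + 1) - ln (real M + 1)"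
  using assms(2)
proof (induction K rule: dec_induct)
  case (step K)
  then show ?case using inverse_Suc_le_ln_diff[of "Suc K"] by (simp add: add.commute)
qed simp

text \<open>
  The term \<open>- theta (N div 2)\<close> later cancels the fractional parts of \<open>N / p\<close> for \<open>p \<le> N div 2\<close>, estimated
  trivially by \<open>1\<close>. This makes the weak bound \<open>theta n \<le> n * ln 4\<close> sufficient.
\<close>

lemma sum_upper_half_primes_le:
  assumes "N \<ge> 2"
  shows "(\<Sum>p\<in>primes_upto N - primes_upto (N div 2). ln (real p) * (real N / real p - 1))
    \<le> - theta (N div 2) + real N * (ln 4 * ln 2) + 2 * ln 4"
proof -
  define M where "M = N div 2"
  have M: "0 < M" "M \<le> N" "2 * M \<le> N" "N + 1 \<le> 2 * (M + 1)" using assms by (auto simp: M_def)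
  have sub: "primes_upto M \<subseteq> primes_upto N" using M by (auto simp: primes_upto_def)
  have "(\<Sum>p\<in>primes_upto N - primes_upto M. ln (real p) * (real N / real p - 1)) =
      real N * (\<Sum>p\<in>primes_upto N - primes_upto M. ln (real p) / real p)
      - (\<Sum>p\<in>primes_upto N - primes_upto M. ln (real p))"
    by (simp add: algebra_simps sum_subtractf sum_distrib_left)
  also have "(\<Sum>p\<in>primes_upto N - primes_upto M. ln (real p)) = theta N - theta M"
    unfolding theta_def using sub by (simp add: sum_diff)
  also have "(\<Sum>p\<in>primes_upto N - primes_upto M. ln (real p) / real p) \<le>
      theta N / real N - theta M / (real M + 1) + ln 4 * ln 2"
  proof -
    \<comment> \<open>Chebyshev's bound leaves a harmonic sum over the upper half of the range,
      which is at most \<open>ln 2\<close>.\<close>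
    have "(\<Sum>j=Suc M..N. theta j / (real j * (real j + 1))) \<le> (\<Sum>j=Suc M..N. ln 4 * (1 / (real j + 1)))"
    proof (rule sum_mono)
      fix j assume "j \<in> {Suc M..N}"
      then have j: "real j > 0" by simp
      have "theta j / (real j * (real j + 1)) \<le> real j * ln 4 / (real j * (real j + 1))"
        using theta_le j by (intro divide_right_mono) auto
      then show "theta j / (real j * (real j + 1)) \<le> ln 4 * (1 / (real j + 1))" using j by simp
    qed
    also have "\<dots> = ln 4 * (\<Sum>j=Suc M..N. 1 / (real j + 1))" by (rule sum_distrib_left[symmetric])
    also have "\<dots> \<le> ln 4 * ln 2"
    proof (rule mult_left_mono)
      have "real N + 1 \<le> 2 * (real M + 1)" using M(4) by (simp flip: of_nat_le_iff[where 'a = real])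
      then have "ln (real N + 1) \<le> ln (2 * (real M + 1))" by (subst ln_le_cancel_iff) auto
      also have "\<dots> = ln 2 + ln (real M + 1)" by (rule ln_mult_pos) auto
      finally show "(\<Sum>j=Suc M..N. 1 / (real j + 1)) \<le> ln 2"
        using sum_inverse_Suc_le[OF M(1,2)] by linarith
    qed simp
    \<comment> \<open>With denominator \<open>N\<close>, multiplication by \<open>N\<close> gives
      exactly the \<open>theta N\<close> that is subtracted.\<close>
    moreover have "theta N / (real N + 1) \<le> theta N / real N"
      using theta_nonneg assms by (intro divide_left_mono) auto
    ultimately show ?thesis using sum_ln_div_prime_by_parts[OF M(2)] by linarith
  qed
  also have "real N * (theta N / real N - theta M / (real M + 1) + ln 4 * ln 2) - (theta N - theta M)
      = theta M * (1 - real N / (real M + 1)) + real N * (ln 4 * ln 2)"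
    using assms by (simp add: algebra_simps)
  \<comment> \<open>The factor is nearly \<open>-1\<close> because \<open>N\<close> is nearly
    \<open>2 * M\<close>. The excess is at most \<open>2 / (M + 1)\<close>, so by Chebyshev's bound
    it costs at most \<open>2 * ln 4\<close>.\<close>
  also have "theta M * (1 - real N / (real M + 1)) \<le> - theta M + 2 * ln 4"
  proof -
    have "2 - real N / (real M + 1) = (2 * (real M + 1) - real N) / (real M + 1)" by (simp add: field_simps)
    also have "\<dots> \<le> 2 / (real M + 1)" using M(3) by (intro divide_right_mono) auto
    finally have "2 - real N / (real M + 1) \<le> 2 / (real M + 1)" .
    then have "theta M * (2 - real N / (real M + 1)) \<le> theta M * (2 / (real M + 1))"
      using theta_nonneg by (intro mult_left_mono)
    also have "\<dots> \<le> (real M * ln 4) * (2 / (real M + 1))" using theta_le by (intro mult_right_mono) auto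
    also have "\<dots> = ln 4 * (2 * real M / (real M + 1))" by simp
    also have "\<dots> \<le> ln 4 * 2" by (intro mult_left_mono) (auto simp: field_simps)
    finally show ?thesis by (simp add: algebra_simps)
  qed
  finally show ?thesis using assms by (simp add: M_def mult_left_mono)
qed

section \<open>Factorials and Legendre's formula\<close>

text \<open>A weak Stirling bound; the induction step rests on
  \<open>1 \<le> (N + 1) * (ln (N + 1) - ln N)\<close>.\<close>

lemma ln_fact_le:
  assumes "N > 0"
  shows "ln (fact N :: real) \<le> N * ln N - N + ln N + 1"
proof -
  from assms have "Suc 0 \<le> N" by simp
  then show ?thesis
  proof (induction N rule: dec_induct)
    case (step N)
    have "1 \<le> (real N + 1) * (ln (real N + 1) - ln (real N))"
      using inverse_Suc_le_ln_diff[of N] step(1) by (simp add: field_simps)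
    moreover have "ln (fact (Suc N) :: real) = ln (real N + 1) + ln (fact N)"
      by (simp add: ln_mult_pos add.commute)
    ultimately show ?case using step(3) by (simp add: algebra_simps)
  qed simp
qed

text \<open>Legendre's formula in logarithmic form, obtained by expanding each \<open>ln m\<close>
  and counting the multiples of \<open>p ^ a\<close> up to \<open>N\<close>.\<close>

lemma ln_fact_eq_sum_primes:
  "ln (fact N :: real) = (\<Sum>p\<in>primes_upto N. ln (real p) * (\<Sum>a=1..N. real (N div p ^ a)))"
proof -
  have "ln (fact N :: real) = ln (\<Prod>m=1..N. real m)" by (simp add: fact_prod)
  also have "\<dots> = (\<Sum>m=1..N. ln (real m))" by (rule ln_prod) auto
  also have "\<dots> = (\<Sum>m=1..N. \<Sum>p\<in>primes_upto N. \<Sum>a=1..N. if p ^ a dvd m then ln (real p) else 0)"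
  proof (rule sum.cong)
    fix m assume m: "m \<in> {1..N}"
    have "p \<le> N" if "p dvd m" for p using dvd_imp_le[OF that] m by auto
    then show "ln (real m) = (\<Sum>p\<in>primes_upto N. \<Sum>a=1..N. if p ^ a dvd m then ln (real p) else 0)"
      using m by (intro ln_eq_sum_prime_powers) (auto simp: primes_upto_def)
  qed simp
  also have "\<dots> = (\<Sum>p\<in>primes_upto N. \<Sum>a=1..N. \<Sum>m=1..N. if p ^ a dvd m then ln (real p) else 0)"
    by (subst sum.swap, rule sum.cong[OF refl], rule sum.swap)
  also have "\<dots> = (\<Sum>p\<in>primes_upto N. \<Sum>a=1..N. ln (real p) * real (N div p ^ a))"
  proof (intro sum.cong refl)
    fix p a assume "p \<in> primes_upto N"
    then have p: "p ^ a > 0" by (auto simp: primes_upto_def dest: prime_gt_0_nat)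
    have "(\<Sum>m=1..N. if p ^ a dvd m then ln (real p) else 0) = real (card {m\<in>{1..N}. p ^ a dvd m}) * ln (real p)"
      by (simp flip: sum.inter_filter)
    also have "{m\<in>{1..N}. p ^ a dvd m} = (*) (p ^ a) ` {1..N div p ^ a}"
      using multiples_eq_image[OF p, of 1 N] p by simp
    also have "card \<dots> = N div p ^ a" using p by (subst card_image) (auto simp: inj_on_def)
    finally show "(\<Sum>m=1..N. if p ^ a dvd m then ln (real p) else 0) = ln (real p) * real (N div p ^ a)"
      by simp
  qed
  finally show ?thesis by (simp only: sum_distrib_left)
qed

lemma real_div_bounds:
  fixes x y :: nat
  assumes "y > 0"
  shows "real (x div y) \<le> real x / real y" "real x / real y \<le> real (x div y) + 1"
proof -
  have "(x div y) * y \<le> x" by simp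
  then have "real (x div y) * real y \<le> real x" by (metis of_nat_le_iff of_nat_mult)
  then show "real (x div y) \<le> real x / real y" using assms by (simp add: field_simps)
  have "x < (x div y + 1) * y" using dividend_less_div_times[of y x] assms by (simp add: mult.commute)
  then have "real x < (real (x div y) + 1) * real y"
    by (metis of_nat_1 of_nat_add of_nat_less_iff of_nat_mult)
  then show "real x / real y \<le> real (x div y) + 1" using assms by (simp add: field_simps)
qed

text \<open>Without rounding, \<open>N / p ^ a\<close> summed over all \<open>a \<ge> 1\<close> is
  \<open>N / (p - 1)\<close>. Rounding and truncation lose at most \<open>e + 1\<close>, where
  \<open>e\<close> is the largest exponent with \<open>p ^ e \<le> N\<close>, and
  \<open>e * ln p \<le> ln N\<close>.\<close>

lemma Legendre_sum_ge:
  fixes p N :: nat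
  assumes "p \<ge> 2" "N \<ge> 1"
  shows "ln (real p) * (real N / (real p - 1)) \<le>
    ln (real p) * (\<Sum>a=1..N. real (N div p ^ a)) + ln (real N) + ln (real p)"
proof -
  obtain e where e: "p ^ e \<le> N" "N < p ^ Suc e"
    using ex_power_ivl1[of p N] assms by auto
  have eN: "e \<le> N"
  proof -
    have "e < 2 ^ e" by simp
    also have "\<dots> \<le> p ^ e" using assms(1) by (intro power_mono) auto
    finally show ?thesis using e(1) by simp
  qed
  \<comment> \<open>The numerator is \<open>N + 1\<close> because
    \<open>N div q \<ge> (N + 1) / q - 1\<close>. The tail beyond \<open>e\<close> then costs only
    \<open>1\<close>, since \<open>N + 1 \<le> p ^ Suc e\<close>.\<close>
  have "real N / (real p - 1) - 1 - real e \<le> (real N + 1) * ((1 - 1 / real p ^ e) / (real p - 1)) - real e"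
  proof -
    have "N + 1 \<le> p * p ^ e" using e(2) by simp
    then have "real N + 1 \<le> real p * real p ^ e" by (metis of_nat_1 of_nat_add of_nat_le_iff of_nat_mult of_nat_power)
    then have "(real N + 1) / real p ^ e \<le> real p" using assms(1) by (simp add: field_simps)
    then have "real N + 1 - real p \<le> (real N + 1) * (1 - 1 / real p ^ e)" by (simp add: algebra_simps)
    then have "(real N + 1 - real p) / (real p - 1) \<le> (real N + 1) * (1 - 1 / real p ^ e) / (real p - 1)"
      using assms(1) by (intro divide_right_mono) auto
    moreover have "(real N + 1 - real p) / (real p - 1) = real N / (real p - 1) - 1"
      using assms(1) by (simp add: field_simps)
    ultimately show ?thesis by simp
  qed
  also have "\<dots> = (real N + 1) * (\<Sum>a=1..e. 1 / real p ^ a) - real e"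
    using assms(1) by (subst sum_inverse_powers) auto
  also have "\<dots> = (\<Sum>a=1..e. (real N + 1) / real p ^ a - 1)"
    by (simp add: sum_subtractf sum_distrib_left)
  also have "\<dots> \<le> (\<Sum>a=1..e. real (N div p ^ a))"
  proof (rule sum_mono)
    fix a
    have q: "p ^ a > 0" using assms(1) by simp
    have "N < (N div p ^ a + 1) * p ^ a" using q
      by (metis add.commute dividend_less_div_times mult_Suc plus_1_eq_Suc)
    then have "N + 1 \<le> (N div p ^ a + 1) * p ^ a" by simp
    then have "real N + 1 \<le> (real (N div p ^ a) + 1) * real p ^ a"
      by (metis of_nat_1 of_nat_add of_nat_le_iff of_nat_mult of_nat_power)
    then show "(real N + 1) / real p ^ a - 1 \<le> real (N div p ^ a)" using assms(1) by (simp add: field_simps)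
  qed
  also have "\<dots> \<le> (\<Sum>a=1..N. real (N div p ^ a))" using eN by (intro sum_mono2) auto
  finally have "real N / (real p - 1) \<le> (\<Sum>a=1..N. real (N div p ^ a)) + real e + 1" by simp
  then have "ln (real p) * (real N / (real p - 1)) \<le> ln (real p) * ((\<Sum>a=1..N. real (N div p ^ a)) + real e + 1)"
    using assms(1) by (intro mult_left_mono) auto
  moreover have "real e * ln (real p) \<le> ln (real N)"
  proof -
    have "real p ^ e \<le> real N" using e(1) by (metis of_nat_le_iff of_nat_power)
    then have "ln (real p ^ e) \<le> ln (real N)" using assms by (subst ln_le_cancel_iff) auto
    then show ?thesis using assms by (simp add: ln_realpow)
  qed
  ultimately show ?thesis by (simp add: algebra_simps)
qed

text \<open>Each term is at most the decrease of \<open>(ln x + 2) / x\<close> from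
  \<open>m - 1\<close> to \<open>m\<close>. The constant \<open>2\<close> comes from the bound
  \<open>(N + 1) / N \<le> 2\<close> in the induction step.\<close>

lemma sum_ln_div_square_le:
  assumes "0 < s" "s \<le> N"
  shows "(\<Sum>m=Suc s..N. ln (real m) / (real m * (real m - 1))) \<le> (ln (real s) + 2) / real s"
proof -
  have "(\<Sum>m=Suc s..N. ln (real m) / (real m * (real m - 1))) \<le> (ln (real s) + 2) / real s - (ln (real N) + 2) / real N"
    using assms(2)
  proof (induction N rule: dec_induct)
    case (step N)
    have N: "real N > 0" "real N \<ge> 1" using assms(1) step(1) by auto
    have "ln (real N + 1) - ln (real N) \<le> 1 / real N"
      using ln_le_minus_one[of "(real N + 1) / real N"] N by (simp add: ln_div field_simps)
    then have "(real N + 1) * (ln (real N + 1) - ln (real N)) \<le> (real N + 1) * (1 / real N)"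
      using N by (intro mult_left_mono) auto
    also have "\<dots> \<le> 2" using N by (simp add: field_simps)
    finally have "ln (real N + 1) + (ln (real N + 1) + 2) * real N \<le> (ln (real N) + 2) * (real N + 1)"
      by (simp add: algebra_simps)
    then have "(ln (real N + 1) + (ln (real N + 1) + 2) * real N) / ((real N + 1) * real N)
        \<le> (ln (real N) + 2) * (real N + 1) / ((real N + 1) * real N)"
      using N by (intro divide_right_mono) auto
    then have "ln (real N + 1) / ((real N + 1) * real N) + (ln (real N + 1) + 2) / (real N + 1)
        \<le> (ln (real N) + 2) / real N"
      using N by (simp add: add_divide_distrib)
    then show ?case using step(1,3) by (simp add: add.commute)
  qed simp
  moreover have "(ln (real N) + 2) / real N \<ge> 0" using assms by simp
  ultimately show ?thesis by linarith
qed

text \<open>Odd primes are determined by \<open>p div 2\<close>; the additional \<open>1\<close>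
  accounts for the prime \<open>2\<close>.\<close>

lemma card_primes_upto_le: "card (primes_upto n) \<le> n div 2 + 1"
proof -
  have "inj_on (\<lambda>p. p div 2) (primes_upto n - {2})"
  proof (rule inj_onI)
    fix p q assume "p \<in> primes_upto n - {2}" "q \<in> primes_upto n - {2}" "p div 2 = q div 2"
    moreover from this have "odd p" "odd q"
      by (auto simp: primes_upto_def) (metis prime_odd_nat prime_ge_2_nat le_neq_implies_less)+
    ultimately show "p = q" by (metis odd_two_times_div_two_succ)
  qed
  moreover have "(\<lambda>p. p div 2) ` (primes_upto n - {2}) \<subseteq> {1..n div 2}"
    by (auto simp: primes_upto_def div_le_mono dest: prime_ge_2_nat)
  ultimately have "card (primes_upto n - {2}) \<le> card {1..n div 2}"
    by (rule card_inj_on_le) simp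
  moreover have "card (primes_upto n) \<le> card (primes_upto n - {2}) + 1"
    by (metis card_Diff_singleton_if diff_le_self le_diff_conv add.commute order_refl Suc_eq_plus1 le_SucI)
  ultimately show ?thesis by simp
qed

section \<open>The Mertens bound for large arguments\<close>

text \<open>Legendre's formula is compared with \<open>N / (p - 1)\<close> on three ranges. Up to
  \<open>s\<close> all powers are used, at a cost of \<open>ln N + ln p\<close>. Beyond
  \<open>s\<close> only \<open>N div p\<close> is used, and \<open>N * t p\<close> pays for the
  higher powers. Rounding \<open>N / p\<close> then costs \<open>ln p\<close> up to
  \<open>M\<close>, and \<open>ln p * (N / p - 1)\<close> above \<open>M\<close>. The costs
  \<open>ln p\<close> add up to \<open>theta M\<close>, which the upper half cancels.\<close>

lemma sum_ln_div_prime_pred_le_raw: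
  fixes N s :: nat
  assumes s: "s ^ 2 \<le> N" "s > 0" "s \<le> N div 2"
  shows "real N * (\<Sum>p\<in>primes_upto N. ln (real p) / (real p - 1)) \<le>
    ln (fact N) + real (card (primes_upto s)) * ln N + real N * (ln 4 * ln 2) + 2 * ln 4
    + real N * ((ln s + 2) / s)"
proof -
  define M where "M = N div 2"
  define t where "t = (\<lambda>p::nat. ln (real p) / (real p * (real p - 1)))"
  define V where "V = (\<lambda>p. \<Sum>a=1..N. real (N div p ^ a))"
  have N: "N \<ge> 2" using assms by linarith
  have sub: "primes_upto s \<subseteq> primes_upto N" "primes_upto M \<subseteq> primes_upto N" "s \<le> N" "s \<le> M"
    using s(3) by (auto simp: primes_upto_def M_def)
  have "real N * (\<Sum>p\<in>primes_upto N. ln (real p) / (real p - 1)) =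
      (\<Sum>p\<in>primes_upto N. ln (real p) * (real N / (real p - 1)))"
    by (simp add: sum_distrib_left mult.commute)
  also have "\<dots> \<le> (\<Sum>p\<in>primes_upto N. ln (real p) * V p
      + (if p \<in> primes_upto s then ln (real N) else real N * t p)
      + (if p \<in> primes_upto M then ln (real p) else ln (real p) * (real N / real p - 1)))"
  proof (rule sum_mono)
    fix p assume "p \<in> primes_upto N"
    then have p: "prime p" "p \<ge> 2" "p \<le> N" by (auto simp: primes_upto_def dest: prime_ge_2_nat)
    have lnp: "ln (real p) \<ge> 0" using p by simp
    show "ln (real p) * (real N / (real p - 1)) \<le> ln (real p) * V p
      + (if p \<in> primes_upto s then ln (real N) else real N * t p)
      + (if p \<in> primes_upto M then ln (real p) else ln (real p) * (real N / real p - 1))"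
    proof (cases "p \<le> s")
      case True
      then have "p \<in> primes_upto s" "p \<in> primes_upto M" using p sub by (auto simp: primes_upto_def)
      then show ?thesis using Legendre_sum_ge[of p N] p N by (simp add: V_def)
    next
      case False
      then have ns: "p \<notin> primes_upto s" by (simp add: primes_upto_def)
      have split: "ln (real p) * (real N / (real p - 1)) = ln (real p) * (real N / real p) + real N * t p"
        using p by (simp add: t_def divide_simps) (simp add: algebra_simps)
      have V: "V p \<ge> real (N div p)"
      proof -
        have "(\<Sum>a\<in>{1}. real (N div p ^ a)) \<le> V p"
          unfolding V_def using N by (intro sum_mono2) auto
        then show ?thesis by simp
      qed
      show ?thesis
      proof (cases "p \<le> M")
        case True
        then have "p \<in> primes_upto M" using p by (simp add: primes_upto_def)
        moreover have "real N / real p \<le> V p + 1"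
          using V real_div_bounds(2)[of p N] p by linarith
        then have "ln (real p) * (real N / real p) \<le> ln (real p) * (V p + 1)"
          using lnp by (rule mult_left_mono)
        ultimately show ?thesis using ns split by (simp add: algebra_simps)
      next
        case False
        then have "p \<notin> primes_upto M" by (simp add: primes_upto_def)
        moreover have "V p \<ge> 1"
        proof -
          have "N div p \<ge> 1" using p by (simp add: Suc_le_eq div_greater_zero_iff)
          then show ?thesis using V by linarith
        qed
        then have "ln (real p) * (real N / real p) \<le> ln (real p) * (V p + (real N / real p - 1))"
          using lnp by (intro mult_left_mono) auto
        ultimately show ?thesis using ns split by (simp add: algebra_simps)
      qed
    qed
  qed
  also have "\<dots> = (\<Sum>p\<in>primes_upto N. ln (real p) * V p)
      + (\<Sum>p\<in>primes_upto N. if p \<in> primes_upto s then ln (real N) else real N * t p)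
      + (\<Sum>p\<in>primes_upto N. if p \<in> primes_upto M then ln (real p) else ln (real p) * (real N / real p - 1))"
    by (simp only: sum.distrib)
  also have "(\<Sum>p\<in>primes_upto N. ln (real p) * V p) = ln (fact N)"
    unfolding V_def by (rule ln_fact_eq_sum_primes[symmetric])
  also have "(\<Sum>p\<in>primes_upto N. if p \<in> primes_upto s then ln (real N) else real N * t p)
      = real (card (primes_upto s)) * ln N + real N * (\<Sum>p\<in>primes_upto N - primes_upto s. t p)"
    using sub by (simp add: sum.If_cases Int_absorb1 Int_commute Diff_eq sum_distrib_left)
  also have "real N * (\<Sum>p\<in>primes_upto N - primes_upto s. t p) \<le> real N * ((ln s + 2) / s)"
  proof (rule mult_left_mono)
    have "(\<Sum>p\<in>primes_upto N - primes_upto s. t p) \<le> (\<Sum>m=Suc s..N. t m)"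
      by (intro sum_mono2) (auto simp: primes_upto_def t_def)
    also have "\<dots> \<le> (ln s + 2) / s"
      unfolding t_def using s(2) sub(3) by (rule sum_ln_div_square_le)
    finally show "(\<Sum>p\<in>primes_upto N - primes_upto s. t p) \<le> (ln s + 2) / s" .
  qed simp
  also have "(\<Sum>p\<in>primes_upto N. if p \<in> primes_upto M then ln (real p) else ln (real p) * (real N / real p - 1))
      = theta M + (\<Sum>p\<in>primes_upto N - primes_upto M. ln (real p) * (real N / real p - 1))"
    using sub by (simp add: sum.If_cases Int_absorb1 Diff_eq theta_def)
  also have "(\<Sum>p\<in>primes_upto N - primes_upto M. ln (real p) * (real N / real p - 1)) \<le>
      - theta M + real N * (ln 4 * ln 2) + 2 * ln 4"
    unfolding M_def using N by (rule sum_upper_half_primes_le)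
  finally show ?thesis by simp
qed

text \<open>Take \<open>s\<close> near \<open>sqrt N\<close> and divide by \<open>N\<close>. The
  main term \<open>ln N\<close> comes from the factorial, whose term \<open>- N\<close> offsets most
  of \<open>N * (ln 4 * ln 2)\<close>; the remaining contributions are small multiples of
  \<open>N\<close>.\<close>

lemma sum_ln_div_prime_pred_le:
  assumes "N \<ge> 1024"
  shows "(\<Sum>p\<in>primes_upto N. ln (real p) / (real p - 1)) \<le> ln (real N) + 3 / 10"
proof -
  define s where "s = floor_sqrt N"
  define x where "x = sqrt (real N)"
  define A where "A = (\<Sum>p\<in>primes_upto N. ln (real p) / (real p - 1))"
  have s2: "s ^ 2 \<le> N" unfolding s_def by simp
  have s32: "s \<ge> 32" unfolding s_def using assms by (simp add: le_floor_sqrt_iff)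
  have "32 * s \<le> s ^ 2" using s32 by (simp add: power2_eq_square)
  then have sM: "s \<le> N div 2" using s2 by linarith
  have xN: "x * x = real N" "x \<ge> 32" unfolding x_def using assms by (auto simp: real_le_rsqrt)
  have sx: "real s \<le> x" unfolding x_def using s2 by (intro real_le_rsqrt) (metis of_nat_le_iff of_nat_power)
  have ln2: "ln (2::real) \<le> 25 / 36" by (rule ln2_le_25_over_36)
  have ln2_0: "ln (2::real) \<ge> 0" by simp
  have ln4: "ln (4::real) = 2 * ln 2" using ln_realpow[of "2::real" 2] by simp
  have ln32: "ln (32::real) = 5 * ln 2" using ln_realpow[of "2::real" 5] by simp
  \<comment> \<open>The tangent of \<open>ln\<close> at \<open>32\<close> is used since
    \<open>ln 32 = 5 * ln 2\<close> has a rational bound.\<close>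
  have lns: "ln (real s) \<le> ln 32 + (real s / 32 - 1)"
    using ln_le_minus_one[of "real s / 32"] s32 by (simp add: ln_div)
  have lnx: "ln x \<le> ln 32 + (x / 32 - 1)"
    using ln_le_minus_one[of "x / 32"] xN by (simp add: ln_div)
  have lnN: "ln (real N) = 2 * ln x" using xN by (simp add: ln_mult_pos flip: xN(1))
  have lnNx: "ln (real N) / x \<le> 7 / 32"
  proof -
    have "ln (real N) \<le> x / 16 + 5" using lnx lnN ln32 ln2 by linarith
    also have "\<dots> \<le> x * (7 / 32)" using xN(2) by linarith
    finally show ?thesis using xN(2) by (simp add: field_simps)
  qed
  have "real N * A \<le> ln (fact N) + real (card (primes_upto s)) * ln N + real N * (ln 4 * ln 2) + 2 * ln 4
      + real N * ((ln s + 2) / s)"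
    unfolding A_def using s2 s32 sM by (intro sum_ln_div_prime_pred_le_raw) auto
  also have "ln (fact N :: real) \<le> N * ln N - N + ln N + 1" using assms by (intro ln_fact_le) auto
  also have "real (card (primes_upto s)) * ln N \<le> (x / 2 + 1) * ln N"
  proof (rule mult_right_mono)
    have "real (card (primes_upto s)) \<le> real (s div 2 + 1)" using card_primes_upto_le of_nat_le_iff by blast
    moreover have "real (s div 2) \<le> real s / 2" by linarith
    ultimately show "real (card (primes_upto s)) \<le> x / 2 + 1" using sx by simp
  qed (use assms in simp)
  also have "real N * ((ln s + 2) / s) \<le> real N * (175 / 1000)"
  proof (rule mult_left_mono)
    have "ln (real s) + 2 \<le> real s * (175 / 1000)" using lns ln32 ln2 s32 by linarith
    then show "(ln (real s) + 2) / real s \<le> 175 / 1000" using s32 by (simp add: field_simps)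
  qed simp
  also have "real N * (ln 4 * ln 2) \<le> real N * (9646 / 10000)"
  proof (rule mult_left_mono)
    have "ln 2 * ln (2::real) \<le> (25 / 36) * (25 / 36)" using ln2 ln2_0 by (intro mult_mono) auto
    then show "ln 4 * ln (2::real) \<le> 9646 / 10000" unfolding ln4 by simp
  qed simp
  also have "2 * ln (4::real) \<le> 3" using ln4 ln2 by linarith
  \<comment> \<open>Here \<open>1396 / 10000 = 175 / 1000 + 9646 / 10000 - 1\<close>. The factor
    \<open>x / 2 + 2\<close> collects the small primes and the extra \<open>ln N\<close> of the
    factorial bound, and \<open>4 = 1 + 3\<close>.\<close>
  finally have "real N * A \<le> real N * (ln N + 1396 / 10000) + (x / 2 + 2) * ln N + 4"
    by (simp add: algebra_simps)
  also have "(x / 2 + 2) * ln N \<le> real N * (1231 / 10000)"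
  proof -
    \<comment> \<open>From \<open>x \<ge> 32\<close>, the summand \<open>2\<close> is at most
      \<open>x / 16\<close>.\<close>
    have "(x / 2 + 2) * ln N \<le> (x / 2 + x / 16) * (x * (7 / 32))"
      using xN(2) lnNx assms by (intro mult_mono) (auto simp: field_simps)
    also have "\<dots> = (x * x) * (63 / 512)" by simp
    also have "\<dots> \<le> (x * x) * (1231 / 10000)" using xN by (intro mult_left_mono) auto
    finally show ?thesis using xN by simp
  qed
  also have "4 \<le> real N * (4 / 1024)" using assms by simp
  finally have "real N * A \<le> real N * (ln N + 1396 / 10000 + 1231 / 10000 + 4 / 1024)"
    by (simp add: algebra_simps)
  then have "A \<le> ln N + 1396 / 10000 + 1231 / 10000 + 4 / 1024"
    using assms by simp
  then show ?thesis unfolding A_def by simp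
qed

section \<open>The Mertens sum for small arguments\<close>

text \<open>Trial division by a fixed list. Composite numbers that pass would only add nonnegative
  terms, so upper bounds for sums over primes stay valid.\<close>

fun no_other_divisor :: "nat \<Rightarrow> nat list \<Rightarrow> bool" where
  "no_other_divisor q [] = True"
| "no_other_divisor q (d # ds) = (q = d \<or> q mod d \<noteq> 0 \<and> no_other_divisor q ds)"

lemma prime_no_other_divisor:
  assumes "prime q" "1 \<notin> set ds"
  shows "no_other_divisor q ds"
  using assms(2)
proof (induction ds)
  case (Cons d ds)
  have "q mod d \<noteq> 0" if "q \<noteq> d"
    using assms(1) that Cons.prems by (auto simp: prime_nat_iff mod_eq_0_iff_dvd)
  with Cons show ?case by (cases "q = d") auto
qed simp

text \<open>
  In units of \<open>1 / 10 ^ 6\<close>, \<open>l\<close> and \<open>u\<close> bound \<open>ln q\<close> from below and above (midpoint and trapezoidal rule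
  for the integral of \<open>1 / x\<close> from \<open>q\<close> to \<open>q + 1\<close>), and \<open>acc\<close> bounds the sum of \<open>ln p / (p - 1)\<close> over the
  primes \<open>p < q\<close> from above.
\<close>

function mertens_check :: "nat \<Rightarrow> nat \<Rightarrow> nat \<Rightarrow> nat \<Rightarrow> nat \<Rightarrow> bool" where
  "mertens_check b q l u acc =
    (if b \<le> q then True
     else if no_other_divisor q [2, 3, 5, 7, 11, 13, 17, 19, 23, 29, 31]
     then (q < 50 \<or> acc + u div (q - 1) + 1 + 300000 \<le> l) \<and>
       mertens_check b (q + 1) (l + 2000000 div (2 * q + 1))
         (u + 1000000 * (2 * q + 1) div (2 * q * (q + 1)) + 1) (acc + u div (q - 1) + 1)
     else (q < 50 \<or> acc + 300000 \<le> l) \<and>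
       mertens_check b (q + 1) (l + 2000000 div (2 * q + 1))
         (u + 1000000 * (2 * q + 1) div (2 * q * (q + 1)) + 1) acc)"
  by pat_completeness auto
termination
proof (relation "measure (\<lambda>(b, q, _). b - q)", goal_cases)
  case (2 b q l u acc)
  from 2(1) show ?case by simp
next
  case (3 b q l u acc)
  from 3(1) show ?case by simp
qed simp

declare mertens_check.simps [simp del]

text \<open>The starting values \<open>693000\<close> and \<open>693200\<close> bracket
  \<open>10 ^ 6 * ln 2\<close>.\<close>

lemma mertens_check_start: "mertens_check 1024 2 693000 693200 0"
  by (simp add: mertens_check.simps)

text \<open>The hypotheses on \<open>l\<close>, \<open>u\<close> and \<open>acc\<close> are the loop
  invariant. The recursion is followed up to \<open>q = N\<close>, where the test made at that point
  gives the claim.\<close>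

lemma mertens_check_correct:
  assumes "mertens_check b q l u acc" "2 \<le> q" "real l \<le> 10 ^ 6 * ln (real q)"
    and "10 ^ 6 * ln (real q) \<le> real u"
    and "10 ^ 6 * (\<Sum>p\<in>primes_upto (q - 1). ln (real p) / (real p - 1)) \<le> real acc"
    and "q \<le> N" "N < b" "50 \<le> N"
  shows "(\<Sum>p\<in>primes_upto N. ln (real p) / (real p - 1)) \<le> ln (real N) - 3 / 10"
  using assms
proof (induction b q l u acc rule: mertens_check.induct)
  case (1 b q l u acc)
  note prems = "1.prems"
  define noD where "noD \<longleftrightarrow> no_other_divisor q [2, 3, 5, 7, 11, 13, 17, 19, 23, 29, 31]"
  define acc' where "acc' = (if noD then acc + u div (q - 1) + 1 else acc)"
  define l' where "l' = l + 2000000 div (2 * q + 1)"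
  define u' where "u' = u + 1000000 * (2 * q + 1) div (2 * q * (q + 1)) + 1"
  have q: "2 \<le> q" "\<not> b \<le> q" using prems(2,6,7) by auto
  have check: "(q < 50 \<or> acc' + 300000 \<le> l) \<and> mertens_check b (q + 1) l' u' acc'"
    using prems(1) q(2) unfolding mertens_check.simps[of b q] acc'_def l'_def u'_def noD_def[symmetric]
    by (simp split: if_splits)
  have acc': "10 ^ 6 * (\<Sum>p\<in>primes_upto q. ln (real p) / (real p - 1)) \<le> real acc'"
  proof -
    have Suc: "q = Suc (q - 1)" using q by simp
    show ?thesis
    proof (cases "prime q")
      case True
      then have noD unfolding noD_def by (rule prime_no_other_divisor) simp
      have "primes_upto q = insert q (primes_upto (q - 1))" "q \<notin> primes_upto (q - 1)"
        using True q primes_upto_Suc[of "q - 1"] by (auto simp: primes_upto_def)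
      then have "10 ^ 6 * (\<Sum>p\<in>primes_upto q. ln (real p) / (real p - 1)) =
          10 ^ 6 * ln (real q) / (real q - 1)
          + 10 ^ 6 * (\<Sum>p\<in>primes_upto (q - 1). ln (real p) / (real p - 1))"
        by (simp add: distrib_left)
      also have "10 ^ 6 * ln (real q) / (real q - 1) \<le> real u / (real q - 1)"
        using prems(4) q by (intro divide_right_mono) auto
      also have "real u / (real q - 1) = real u / real (q - 1)" using q by (simp add: of_nat_diff)
      also have "\<dots> \<le> real (u div (q - 1)) + 1" using q by (intro real_div_bounds(2)) simp
      finally show ?thesis using prems(5) \<open>noD\<close> by (simp add: acc'_def)
    next
      case False
      then have "primes_upto q = primes_upto (q - 1)" using primes_upto_Suc[of "q - 1"] q by simp
      moreover have "real acc \<le> real acc'" by (simp add: acc'_def)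
      ultimately show ?thesis using prems(5) by simp
    qed
  qed
  show ?case
  proof (cases "N = q")
    case True
    then have "real acc' + 300000 \<le> real l" using check prems(8) by linarith
    then show ?thesis using acc' prems(3) True by simp
  next
    case False
    have l': "real l' \<le> 10 ^ 6 * ln (real (q + 1))"
    proof -
      have "real (2000000 div (2 * q + 1)) \<le> 10 ^ 6 * (2 / (2 * real q + 1))"
        using real_div_bounds(1)[of "2 * q + 1" 2000000] by (simp add: add.commute)
      also have "\<dots> \<le> 10 ^ 6 * (ln (real q + 1) - ln (real q))"
        using ln_inverse_approx_ge[of "real q" "real q + 1"] q by (intro mult_left_mono) auto
      finally show ?thesis using prems(3) unfolding l'_def by (simp add: algebra_simps)
    qed
    have u': "10 ^ 6 * ln (real (q + 1)) \<le> real u'"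
    proof -
      have "ln (real q + 1) - ln (real q) \<le> (2 * real q + 1) / (2 * real q * (real q + 1))"
        using ln_inverse_approx_le[of "real q" 1] q by (simp add: field_simps)
      then have "10 ^ 6 * (ln (real q + 1) - ln (real q)) \<le>
          10 ^ 6 * ((2 * real q + 1) / (2 * real q * (real q + 1)))"
        by (rule mult_left_mono) simp
      also have "\<dots> = real (1000000 * (2 * q + 1)) / real (2 * q * (q + 1))" by (simp add: algebra_simps)
      also have "\<dots> \<le> real (1000000 * (2 * q + 1) div (2 * q * (q + 1))) + 1"
        using q by (intro real_div_bounds(2)) simp
      finally show ?thesis using prems(4) unfolding u'_def by (simp add: algebra_simps)
    qed
    show ?thesis
    proof (cases noD)
      case True
      show ?thesis
        using "1.IH"(1)[OF q(2) True[unfolded noD_def]] check l' u' acc' q prems(6-8) False True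
        unfolding acc'_def l'_def u'_def by simp
    next
      case nF: False
      show ?thesis
        using "1.IH"(2)[OF q(2) nF[unfolded noD_def]] check l' u' acc' q prems(6-8) False nF
        unfolding acc'_def l'_def u'_def by simp
    qed
  qed
qed

lemma ln_2_bounds: "693 / 1000 \<le> ln (2::real)" "ln (2::real) \<le> 69316 / 100000"
  using ln_approx_bounds[of 2 3] by (simp_all add: eval_nat_numeral)

text \<open>In contrast to the bound for \<open>N \<ge> 1024\<close>, the constant
  \<open>3 / 10\<close> is subtracted. This gain compensates for the larger error terms of the
  density argument in this range.\<close>

lemma sum_ln_div_prime_pred_le_table:
  assumes "50 \<le> N" "N < 1024"
  shows "(\<Sum>p\<in>primes_upto N. ln (real p) / (real p - 1)) \<le> ln (real N) - 3 / 10"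
proof (rule mertens_check_correct[OF mertens_check_start])
  have "primes_upto (2 - 1) = {}" by (auto simp: primes_upto_def dest: prime_ge_2_nat)
  then show "10 ^ 6 * (\<Sum>p\<in>primes_upto (2 - 1). ln (real p) / (real p - 1)) \<le> real 0" by simp
qed (use assms ln_2_bounds in auto)

section \<open>Smooth numbers in short ranges\<close>

text \<open>The primes below \<open>60\<close>. If \<open>5 * n < 60 * 59\<close>, no larger prime
  satisfies \<open>p * (p - 1) \<le> 5 * n\<close>.\<close>

definition small_primes :: "nat list" where
  "small_primes = [2, 3, 5, 7, 11, 13, 17, 19, 23, 29, 31, 37, 41, 43, 47, 53, 59]"

lemma small_primes_complete:
  fixes p :: nat
  assumes "prime p" "p < 60"
  shows "p \<in> set small_primes"
proof -
  \<comment> \<open>Below \<open>11 ^ 2\<close> the divisors \<open>2\<close>, \<open>3\<close>,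
    \<open>5\<close>, \<open>7\<close> detect every composite number.\<close>
  have "\<forall>q\<in>set [2..<60]. no_other_divisor q [2, 3, 5, 7] \<longrightarrow>
      q \<in> set small_primes"
    by (simp add: small_primes_def)
  moreover have "p \<in> set [2..<60]"
    unfolding set_upt using assms prime_ge_2_nat by (simp only: atLeastLessThan_iff)
  moreover have "no_other_divisor p [2, 3, 5, 7]"
    using assms(1) by (rule prime_no_other_divisor) simp
  ultimately show ?thesis by (simp only: HOL.simp_thms)
qed

text \<open>
  An upper bound, in units of \<open>1 / 10 ^ 6\<close>, for the sum of \<open>1 / m\<close> over all \<open>m\<close> in \<open>{a..b}\<close> that are \<open>d\<close> times
  a product of primes from the list. Stopping at \<open>b < d * p\<close> is sound only for sorted lists; the tests
  \<open>p \<le> 1\<close> and \<open>d = 0\<close> serve termination.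
\<close>

function smooth_sum :: "nat \<Rightarrow> nat \<Rightarrow> nat list \<Rightarrow> nat \<Rightarrow> nat" where
  "smooth_sum a b [] d = (if a \<le> d then 10 ^ 6 div d + 1 else 0)"
| "smooth_sum a b (p # ps) d =
    (if p \<le> 1 \<or> d = 0 \<or> b < d * p then if a \<le> d then 10 ^ 6 div d + 1 else 0
     else smooth_sum a b ps d + smooth_sum a b (p # ps) (d * p))"
  by pat_completeness auto
termination
proof (relation "measures [\<lambda>(a, b, ps, d). length ps, \<lambda>(a, b, ps, d). b - d]", goal_cases)
  case (3 a b p ps d)
  then have "d < d * p" "d * p \<le> b" by auto
  then have "b - d * p < b - d" by linarith
  then show ?case by simp
qed auto

declare smooth_sum.simps [simp del]

text \<open>The two recursive calls match a partition of \<open>X\<close>: either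
  \<open>d * p\<close> divides \<open>m\<close>, or \<open>p\<close> does not divide
  \<open>m div d\<close> and can leave the list.\<close>

lemma smooth_sum_correct:
  assumes "sorted ps" "\<forall>p\<in>set ps. 1 < p" "d > 0"
    and "X \<subseteq> {m\<in>{a..b}. d dvd m \<and> (\<forall>q. prime q \<longrightarrow> q dvd m div d \<longrightarrow> q \<in> set ps)}"
  shows "10 ^ 6 * (\<Sum>m\<in>X. 1 / real m) \<le> real (smooth_sum a b ps d)"
  using assms
proof (induction a b ps d arbitrary: X rule: smooth_sum.induct)
  have leaf: "10 ^ 6 * (\<Sum>m\<in>X. 1 / real m) \<le> real (if a \<le> d then 10 ^ 6 div d + 1 else 0)"
    if "X \<subseteq> {d}" "d \<in> X \<Longrightarrow> a \<le> d" "d > 0" for X and a d :: nat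
  proof (cases "X = {}")
    case False
    with that have X: "X = {d}" "a \<le> d" by auto
    have "(10::nat) ^ 6 < (10 ^ 6 div d + 1) * d"
      using dividend_less_div_times[of d "10 ^ 6"] that(3) by (simp add: mult.commute)
    then have "real (10 ^ 6) < real ((10 ^ 6 div d + 1) * d)" by (simp only: of_nat_less_iff)
    then have "10 ^ 6 * (1 / real d) \<le> real (10 ^ 6 div d + 1)"
      using that(3) by (simp add: field_simps)
    then show ?thesis using X by simp
  qed simp
  {
    case (1 a b d)
    have "m = d" if "m \<in> X" for m
    proof -
      have m: "d dvd m" "\<And>q. prime q \<Longrightarrow> \<not> q dvd m div d" using that 1(4) by auto
      then have "m div d = 1" using prime_factor_nat by blast
      then show ?thesis using m(1) by (metis dvd_mult_div_cancel mult.right_neutral)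
    qed
    moreover have "a \<le> m" if "m \<in> X" for m using that 1(4) by auto
    ultimately have "10 ^ 6 * (\<Sum>m\<in>X. 1 / real m) \<le> real (if a \<le> d then 10 ^ 6 div d + 1 else 0)"
      using 1(3) by (intro leaf) blast+
    then show ?case by (simp only: smooth_sum.simps)
  next
    case (2 a b p ps d)
    have p: "1 < p" using 2 by simp
    show ?case
    proof (cases "b < d * p")
      case True
      have "m = d" if "m \<in> X" for m
      proof (rule ccontr)
        assume "m \<noteq> d"
        have m: "d dvd m" "m \<le> b" "a \<le> m" "\<And>q. prime q \<Longrightarrow> q dvd m div d \<Longrightarrow> q \<in> set (p # ps)"
          using that 2(6) by auto
        have "m div d \<noteq> 1" using m(1) \<open>m \<noteq> d\<close> by (metis dvd_mult_div_cancel mult.right_neutral)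
        then obtain q where q: "prime q" "q dvd m div d" using prime_factor_nat by blast
        then have "p \<le> q" using m(4)[OF q] 2(3) by auto
        show False
        proof (cases "m = 0")
          case True
          \<comment> \<open>The number \<open>0\<close> is divisible by every prime, including one
            beyond the finite list.\<close>
          have "\<exists>r. prime r \<and> r > Max (set (p # ps))" using bigger_prime by blast
          then obtain r where r: "prime r" "r > Max (set (p # ps))" by blast
          have "r \<in> set (p # ps)" by (rule m(4)[OF r(1)]) (use True in simp)
          then show False using r(2) by (meson List.finite_set Max_ge leD)
        next
          case False
          then have "m div d > 0" using m(1) by (auto elim!: dvdE)
          then have "p \<le> m div d" using dvd_imp_le[OF q(2)] \<open>p \<le> q\<close> by simp
          then have "d * p \<le> d * (m div d)" by simp
          also have "\<dots> = m" using m(1) by simp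
          finally show False using m(2) True \<open>b < d * p\<close> by simp
        qed
      qed
      moreover have "a \<le> m" if "m \<in> X" for m using that 2(6) by auto
      ultimately have "10 ^ 6 * (\<Sum>m\<in>X. 1 / real m) \<le> real (if a \<le> d then 10 ^ 6 div d + 1 else 0)"
        using 2(5) by (intro leaf) blast+
      then show ?thesis using True by (simp only: smooth_sum.simps(2)[of a b p ps d] simp_thms if_True)
    next
      case False
      define Y where "Y = {m\<in>X. d * p dvd m}"
      have finX: "finite X" using 2(6) finite_subset by fastforce
      have "Y \<subseteq> {m\<in>{a..b}. d * p dvd m \<and> (\<forall>q. prime q \<longrightarrow> q dvd m div (d * p) \<longrightarrow> q \<in> set (p # ps))}"
      proof
        fix m assume "m \<in> Y"
        then have m: "m \<in> X" "d * p dvd m" by (auto simp: Y_def)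
        have "m div (d * p) dvd m div d"
          using m(2) 2(5) p by (auto elim!: dvdE simp: mult.assoc)
        then show "m \<in> {m\<in>{a..b}. d * p dvd m \<and> (\<forall>q. prime q \<longrightarrow> q dvd m div (d * p) \<longrightarrow> q \<in> set (p # ps))}"
          using m 2(6) dvd_trans[of _ "m div (d * p)" "m div d"] by blast
      qed
      then have Y: "10 ^ 6 * (\<Sum>m\<in>Y. 1 / real m) \<le> real (smooth_sum a b (p # ps) (d * p))"
        using 2 False p by (intro 2(2)) auto
      have "X - Y \<subseteq> {m\<in>{a..b}. d dvd m \<and> (\<forall>q. prime q \<longrightarrow> q dvd m div d \<longrightarrow> q \<in> set ps)}"
      proof
        fix m assume "m \<in> X - Y"
        then have m: "m \<in> X" "\<not> d * p dvd m" by (auto simp: Y_def)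
        then have "\<not> p dvd m div d" using 2(6) 2(5)
          by (metis (no_types, lifting) dvd_mult_div_cancel mem_Collect_eq mult_dvd_mono dvd_refl subsetD)
        moreover have "q = p \<or> q \<in> set ps" if "prime q" "q dvd m div d" for q
          using m(1) 2(6) that by auto
        ultimately show "m \<in> {m\<in>{a..b}. d dvd m \<and> (\<forall>q. prime q \<longrightarrow> q dvd m div d \<longrightarrow> q \<in> set ps)}"
          using m(1) 2(6) by blast
      qed
      then have "10 ^ 6 * (\<Sum>m\<in>X - Y. 1 / real m) \<le> real (smooth_sum a b ps d)"
        using 2 False p by (intro 2(1)) auto
      moreover have "(\<Sum>m\<in>X. 1 / real m) = (\<Sum>m\<in>X - Y. 1 / real m) + (\<Sum>m\<in>Y. 1 / real m)"
        using finX by (intro sum.subset_diff) (auto simp: Y_def)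
      ultimately show ?thesis using Y False p 2(5) by (simp add: distrib_left smooth_sum.simps(2)[of a b p ps d])
    qed
  }
qed

text \<open>One evaluation serves all \<open>n\<close> between \<open>N\<close> and
  \<open>N'\<close>: both the interval and the set of admissible primes are enlarged to ones
  independent of \<open>n\<close>.\<close>

lemma not_coverable_interval_block:
  assumes n: "N \<le> n" "n \<le> N'" "N > 0" and small: "5 * N' < 60 * 59"
    and "smooth_sum N (6 * N') (filter (\<lambda>p. p * (p - 1) \<le> 5 * N') small_primes) 1 < 10 ^ 6"
  shows "\<not> coverable {n..6 * n}"
proof
  define S where "S = {m\<in>{n..6 * n}. \<forall>p. prime p \<longrightarrow> p dvd m \<longrightarrow> p * (p - 1) \<le> 5 * n}"
  define ps where "ps = filter (\<lambda>p. p * (p - 1) \<le> 5 * N') small_primes"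
  assume "coverable {n..6 * n}"
  then have "coverable S" unfolding S_def using n by (intro coverable_interval_smooth) auto
  then have ge: "1 \<le> (\<Sum>m\<in>S. 1 / real m)"
    by (rule coverable_imp_sum_ge_1) (use n in \<open>auto simp: S_def\<close>)
  have "(10::real) ^ 6 * 1 \<le> 10 ^ 6 * (\<Sum>m\<in>S. 1 / real m)"
    using ge by (rule mult_left_mono) simp
  also have "10 ^ 6 * (\<Sum>m\<in>S. 1 / real m) \<le> real (smooth_sum N (6 * N') ps 1)"
  proof (rule smooth_sum_correct)
    show "sorted ps" unfolding ps_def by (intro sorted_wrt_filter) (simp add: small_primes_def)
    show "\<forall>p\<in>set ps. 1 < p" unfolding ps_def by (simp add: small_primes_def)
    have "p \<in> set ps" if "prime p" "p * (p - 1) \<le> 5 * n" for p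
    proof -
      have "p * (p - 1) \<le> 5 * N'" using that(2) n(2) by linarith
      moreover have "p < 60"
      proof (rule ccontr)
        assume "\<not> p < 60"
        then have "60 * 59 \<le> p * (p - 1)" by (intro mult_le_mono) auto
        with \<open>p * (p - 1) \<le> 5 * N'\<close> small show False by linarith
      qed
      ultimately show ?thesis using small_primes_complete[OF that(1)] by (simp add: ps_def)
    qed
    then show "S \<subseteq> {m\<in>{N..6 * N'}. 1 dvd m \<and> (\<forall>q. prime q \<longrightarrow> q dvd m div 1 \<longrightarrow> q \<in> set ps)}"
      using n by (auto simp: S_def)
  qed simp
  also have "\<dots> < real (10 ^ 6)"
    using assms(5) unfolding ps_def by (simp only: of_nat_less_iff)
  finally show False by simp
qed

lemma not_coverable_interval_le_680:
  assumes "7 \<le> n" "n \<le> 680" "n \<noteq> 9"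
  shows "\<not> coverable {n..6 * n}"
proof -
  have "\<not> coverable {n..6 * n}" if "7 \<le> n" "n \<le> 8"
    by (rule not_coverable_interval_block[OF that]) (simp_all add: small_primes_def smooth_sum.simps)
  moreover
  have "\<not> coverable {n..6 * n}" if "10 \<le> n" "n \<le> 10"
    by (rule not_coverable_interval_block[OF that]) (simp_all add: small_primes_def smooth_sum.simps)
  moreover
  have "\<not> coverable {n..6 * n}" if "11 \<le> n" "n \<le> 13"
    by (rule not_coverable_interval_block[OF that]) (simp_all add: small_primes_def smooth_sum.simps)
  moreover
  have "\<not> coverable {n..6 * n}" if "14 \<le> n" "n \<le> 19"
    by (rule not_coverable_interval_block[OF that]) (simp_all add: small_primes_def smooth_sum.simps)
  moreover
  have "\<not> coverable {n..6 * n}" if "20 \<le> n" "n \<le> 25"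
    by (rule not_coverable_interval_block[OF that]) (simp_all add: small_primes_def smooth_sum.simps)
  moreover
  have "\<not> coverable {n..6 * n}" if "26 \<le> n" "n \<le> 31"
    by (rule not_coverable_interval_block[OF that]) (simp_all add: small_primes_def smooth_sum.simps)
  moreover
  have "\<not> coverable {n..6 * n}" if "32 \<le> n" "n \<le> 54"
    by (rule not_coverable_interval_block[OF that]) (simp_all add: small_primes_def smooth_sum.simps)
  moreover
  have "\<not> coverable {n..6 * n}" if "55 \<le> n" "n \<le> 85"
    by (rule not_coverable_interval_block[OF that]) (simp_all add: small_primes_def smooth_sum.simps)
  moreover
  have "\<not> coverable {n..6 * n}" if "86 \<le> n" "n \<le> 162"
    by (rule not_coverable_interval_block[OF that]) (simp_all add: small_primes_def smooth_sum.simps)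
  moreover
  have "\<not> coverable {n..6 * n}" if "163 \<le> n" "n \<le> 325"
    by (rule not_coverable_interval_block[OF that]) (simp_all add: small_primes_def smooth_sum.simps)
  moreover
  have "\<not> coverable {n..6 * n}" if "326 \<le> n" "n \<le> 680"
    by (rule not_coverable_interval_block[OF that]) (simp_all add: small_primes_def smooth_sum.simps)
  ultimately show ?thesis using assms by linarith
qed

section \<open>Large intervals\<close>

text \<open>Comparing integer powers with powers of \<open>2\<close> reduces a logarithm to
  \<open>ln 2\<close>; for instance, \<open>5 ^ 31 \<le> 2 ^ 72\<close> bounds
  \<open>ln 5\<close>.\<close>

lemma ln_le_of_power_le:
  fixes x :: real
  assumes "x > 0" "k > 0" "x ^ k \<le> 2 ^ j"
  shows "ln x \<le> real j / real k * ln 2"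
proof -
  have "ln (x ^ k) \<le> ln (2 ^ j)" using assms by (subst ln_le_cancel_iff) auto
  then have "real k * ln x \<le> real j * ln 2" using assms by (simp add: ln_realpow)
  then show ?thesis using assms by (simp add: field_simps)
qed

lemma ln_ge_of_power_ge:
  fixes x :: real
  assumes "x > 0" "k > 0" "2 ^ j \<le> x ^ k"
  shows "real j / real k * ln 2 \<le> ln x"
proof -
  have "ln (2 ^ j) \<le> ln (x ^ k)" using assms by (subst ln_le_cancel_iff) auto
  then have "real j * ln 2 \<le> real k * ln x" using assms by (simp add: ln_realpow)
  then show ?thesis using assms by (simp add: field_simps)
qed

lemma ln_5_le: "ln (5::real) \<le> 161 / 100"
  using ln_le_of_power_le[of 5 31 72] ln_2_bounds by simp

lemma ln_6_le: "ln (6::real) \<le> 1793 / 1000"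
  using ln_le_of_power_le[of 6 41 106] ln_2_bounds by simp

text \<open>Meant for \<open>L = ln n\<close> and \<open>a = ln 6\<close>. The trapezoidal bound for
  \<open>ln (L + a) - ln L\<close> turns the claim into a quadratic inequality in \<open>L\<close>.
  In \<open>quad\<close> one factor \<open>L\<close> of the leading term is lowered to
  \<open>L0\<close>, leaving a linear inequality; \<open>lead\<close> justifies this.\<close>

lemma smooth_density_less_1:
  fixes L A a \<beta> \<epsilon> :: real
  assumes L: "0 < L0" "L0 \<le> L" and a: "0 < a" "a \<le> a'" and A: "0 \<le> A" "A \<le> L / 2 + \<beta>"
    and lead: "0 \<le> 2 * (1 - \<epsilon>) - a'"
    and quad: "a' * (a' / 2 + 2 * \<beta> - 2 * (1 - \<epsilon>)) * L + \<beta> * a' * a' < (2 * (1 - \<epsilon>) - a') * L0 * L"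
  shows "(ln (L + a) - ln L) * A + \<epsilon> < 1"
proof -
  have "(2 * (1 - \<epsilon>) - a') * (L0 * L) \<le> (2 * (1 - \<epsilon>) - a') * (L * L)"
    using L lead by (intro mult_left_mono mult_right_mono) auto
  then have poly: "(L / 2 + \<beta>) * (a' * (2 * L + a')) < (1 - \<epsilon>) * (2 * L * (L + a'))"
    using quad by (simp add: algebra_simps)
  have "ln (L + a) - ln L \<le> ln (L + a') - ln L" using L a by simp
  also have "\<dots> \<le> a' * (inverse L + inverse (L + a')) / 2"
    using L a by (intro ln_inverse_approx_le) auto
  also have "\<dots> = a' * (2 * L + a') / (2 * L * (L + a'))"
    using L a by (simp add: field_simps)
  finally have D: "ln (L + a) - ln L \<le> a' * (2 * L + a') / (2 * L * (L + a'))" .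
  have "(ln (L + a) - ln L) * A \<le> a' * (2 * L + a') / (2 * L * (L + a')) * (L / 2 + \<beta>)"
    using D A L a by (intro mult_mono) auto
  also have "\<dots> = (L / 2 + \<beta>) * (a' * (2 * L + a')) / (2 * L * (L + a'))" by simp
  also have "\<dots> < 1 - \<epsilon>"
    using poly L a by (subst pos_divide_less_eq) auto
  finally show ?thesis by simp
qed

lemma not_coverable_interval_ge_681:
  assumes "n \<ge> 681"
  shows "\<not> coverable {n..6 * n}"
proof
  assume cov: "coverable {n..6 * n}"
  define S where "S = {m\<in>{n..6 * n}. \<forall>p. prime p \<longrightarrow> p dvd m \<longrightarrow> p * (p - 1) \<le> 5 * n}"
  \<comment> \<open>A bound for the prime factors in \<open>S\<close>: a prime \<open>p > N\<close>
    has \<open>p * (p - 1) > 5 * n\<close>. Minimality gives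
    \<open>N * (N - 1) \<le> 5 * n\<close>.\<close>
  define N where "N = (LEAST k. 5 * n < (k + 1) * k)"
  define L where "L = ln (real n)"
  define A where "A = (\<Sum>p\<in>primes_upto N. ln (real p) / (real p - 1))"
  define \<delta> where "\<delta> = 1 / (real N - 1)"
  define E where "E = real (card (primes_upto N)) * ln (real (6 * n)) / (real n * ln (real n))"
  have "5 * n < (5 * n + 1) * (5 * n)" using assms by simp
  then have N1: "5 * n < (N + 1) * N" unfolding N_def by (rule LeastI)
  have N0: "N > 0" using N1 by (cases N) auto
  then have "\<not> 5 * n < (N - 1 + 1) * (N - 1)" unfolding N_def by (intro not_less_Least) simp
  then have N2: "N * (N - 1) \<le> 5 * n" using N0 by simp
  have N58: "58 \<le> N"
  proof (rule ccontr)
    assume "\<not> 58 \<le> N"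
    then have "(N + 1) * N \<le> 58 * 57" by (intro mult_le_mono) auto
    with N1 assms show False by linarith
  qed
  have N2': "real N * (real N - 1) \<le> 5 * real n"
  proof -
    have "real (N * (N - 1)) \<le> real (5 * n)" using N2 by (simp only: of_nat_le_iff)
    then show ?thesis using N0 by (simp add: of_nat_diff)
  qed
  have n0: "real n > 0" using assms by simp
  have ln6n: "ln (real (6 * n)) = L + ln 6" unfolding L_def using n0 by (simp add: ln_mult_pos)
  have A0: "A \<ge> 0" unfolding A_def by (intro sum_nonneg) (auto simp: primes_upto_def dest: prime_gt_0_nat)
  \<comment> \<open>Half the logarithm of \<open>N * (N - 1) \<le> 5 * n\<close>;
    \<open>805 / 1000\<close> is half the bound for \<open>ln 5\<close>, and \<open>\<delta>\<close>
    bounds \<open>ln N - ln (N - 1)\<close>.\<close>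
  have lnN: "ln (real N) \<le> L / 2 + 805 / 1000 + \<delta> / 2"
  proof -
    have "ln (real N * (real N - 1)) \<le> ln (5 * real n)" using N2' N58 n0 by (subst ln_le_cancel_iff) auto
    then have "ln (real N) + ln (real N - 1) \<le> ln 5 + L"
      using N58 n0 by (simp add: ln_mult_pos L_def)
    moreover have "ln (real N) - ln (real N - 1) \<le> \<delta>"
    proof -
      have "ln (real N / (real N - 1)) \<le> real N / (real N - 1) - 1" using N58 by (intro ln_le_minus_one) auto
      also have "\<dots> = 1 / (real N - 1)" using N58 by (simp add: field_simps)
      finally show ?thesis using N58 by (simp add: ln_div \<delta>_def)
    qed
    ultimately show ?thesis using ln_5_le by linarith
  qed
  have E_le: "E \<le> c * (1 + 1793 / 1000 / L0)"
    if "real N / 2 + 1 \<le> c * real n" "0 < L0" "L0 \<le> L" "0 \<le> c" for c L0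
  proof -
    have L: "L > 0" using that by linarith
    have "real (card (primes_upto N)) \<le> real (N div 2 + 1)" using card_primes_upto_le of_nat_le_iff by blast
    also have "\<dots> \<le> real N / 2 + 1" by simp
    finally have "real (card (primes_upto N)) \<le> c * real n" using that(1) by linarith
    then have "real (card (primes_upto N)) / real n \<le> c" using n0 by (simp add: field_simps)
    moreover have "(L + ln 6) / L \<le> 1 + 1793 / 1000 / L0"
    proof -
      have "ln 6 / L \<le> (1793 / 1000) / L0" using ln_6_le that L by (intro frac_le) auto
      then show ?thesis using L by (simp add: add_divide_distrib)
    qed
    ultimately have "real (card (primes_upto N)) / real n * ((L + ln 6) / L) \<le> c * (1 + 1793 / 1000 / L0)"
      using that(4) L by (intro mult_mono) auto
    then show ?thesis unfolding E_def ln6n by (simp add: L_def)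
  qed
  have "(ln (L + ln 6) - ln L) * A + E < 1"
  proof (cases "N < 1024")
    case True
    have L: "13 / 2 \<le> L"
    proof -
      \<comment> \<open>This gives \<open>L \<ge> 47 / 5 * ln 2\<close>, which exceeds
        \<open>13 / 2\<close>.\<close>
      have "(2::real) ^ 47 \<le> 681 ^ 5" by simp
      also have "\<dots> \<le> real n ^ 5" using assms by (intro power_mono) auto
      finally have "real 47 / real 5 * ln 2 \<le> L" unfolding L_def by (intro ln_ge_of_power_ge) (use n0 in auto)
      then show ?thesis using ln_2_bounds by simp
    qed
    have "\<delta> \<le> 1 / 57" unfolding \<delta>_def using N58 by (intro frac_le) auto
    \<comment> \<open>The constant rounds up \<open>805 / 1000 + 1 / 114 - 3 / 10\<close>.\<close>
    then have "A \<le> L / 2 + 515 / 1000"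
      using sum_ln_div_prime_pred_le_table[of N] lnN N58 True unfolding A_def by linarith
    moreover have "E \<le> 6 / 100"
    proof -
      have "real N * 57 \<le> real N * (real N - 1)" using N58 by (intro mult_left_mono) auto
      then have "real N / 2 + 1 \<le> (46 / 1000) * real n" using N2' N58 by linarith
      from E_le[OF this _ L] show ?thesis by simp
    qed
    ultimately show ?thesis
      using smooth_density_less_1[of "13 / 2" L "ln 6" "1793 / 1000" A "515 / 1000" "6 / 100"] L A0 ln_6_le by simp
  next
    case False
    then have N1024: "real N \<ge> 1024" by simp
    have nbig: "real N * 1023 \<le> 5 * real n"
    proof -
      have "real N * 1023 \<le> real N * (real N - 1)" using N1024 by (intro mult_left_mono) auto
      then show ?thesis using N2' by linarith
    qed
    have L: "12 \<le> L"
    proof -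
      \<comment> \<open>The base \<open>209510\<close> is \<open>1024 * 1023 / 5\<close> rounded
        down, a lower bound for \<open>n\<close>.\<close>
      have "(2::real) ^ 35 \<le> 209510 ^ 2" by simp
      also have "\<dots> \<le> real n ^ 2" using nbig N1024 by (intro power_mono) auto
      finally have "real 35 / real 2 * ln 2 \<le> L" unfolding L_def by (intro ln_ge_of_power_ge) (use n0 in auto)
      then show ?thesis using ln_2_bounds by simp
    qed
    have "\<delta> \<le> 1 / 1000" unfolding \<delta>_def using N1024 by (intro frac_le) auto
    then have "A \<le> L / 2 + 1106 / 1000"
      using sum_ln_div_prime_pred_le[of N] lnN False unfolding A_def by linarith
    moreover have "E \<le> 4 / 1000"
    proof -
      have "real N / 2 + 1 \<le> (25 / 10000) * real n" using nbig N1024 by linarith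
      from E_le[OF this _ L] show ?thesis by simp
    qed
    ultimately show ?thesis
      using smooth_density_less_1[of 12 L "ln 6" "1793 / 1000" A "1106 / 1000" "4 / 1000"] L A0 ln_6_le by simp
  qed
  moreover have "(\<Sum>m\<in>S. 1 / real m) \<le> (ln (L + ln 6) - ln L) * A + E"
  proof -
    have "p \<in> primes_upto N" if "m \<in> S" "prime p" "p dvd m" for m p
    proof (rule ccontr)
      assume "p \<notin> primes_upto N"
      then have "N + 1 \<le> p" using that(2) by (simp add: primes_upto_def)
      then have "(N + 1) * N \<le> p * (p - 1)" by (intro mult_le_mono) auto
      moreover have "p * (p - 1) \<le> 5 * n" using that by (auto simp: S_def)
      ultimately show False using N1 by linarith
    qed
    then have "(\<Sum>m\<in>S. 1 / real m) \<le> (ln (ln (real (6 * n))) - ln (ln (real n))) * A + E"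
      unfolding A_def E_def using assms
      by (intro sum_inverse_smooth_le) (auto simp: S_def primes_upto_def)
    then show ?thesis unfolding ln6n by (simp add: L_def)
  qed
  moreover have "1 \<le> (\<Sum>m\<in>S. 1 / real m)"
  proof (rule coverable_imp_sum_ge_1)
    show "coverable S" unfolding S_def using cov assms by (intro coverable_interval_smooth) auto
  qed (use assms in \<open>auto simp: S_def\<close>)
  ultimately show False by linarith
qed

section \<open>The exceptional small cases and the theorem\<close>

text \<open>Runs through a schedule of prime powers, skipping those that still have too many
  multiples. The order matters because each removal can make later entries sparse.\<close>

fun drop_sparse :: "(nat \<times> nat) list \<Rightarrow> nat list \<Rightarrow> nat list" where
  "drop_sparse [] xs = xs"
| "drop_sparse ((p, a) # ps) xs = drop_sparse ps
    (if length (filter (\<lambda>m. p ^ a dvd m) xs) < p then filter (\<lambda>m. \<not> p ^ a dvd m) xs else xs)"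

lemma coverable_drop_sparse:
  assumes "coverable (set xs)" "0 \<notin> set xs" "\<forall>(p, a)\<in>set ps. prime p \<and> a > 0"
  shows "coverable (set (drop_sparse ps xs)) \<and> set (drop_sparse ps xs) \<subseteq> set xs"
  using assms
proof (induction ps xs rule: drop_sparse.induct)
  case (2 p a ps xs)
  define ys where "ys = (if length (filter (\<lambda>m. p ^ a dvd m) xs) < p
    then filter (\<lambda>m. \<not> p ^ a dvd m) xs else xs)"
  have "coverable (set ys)"
  proof (cases "length (filter (\<lambda>m. p ^ a dvd m) xs) < p")
    case True
    have "card {m\<in>set xs. p ^ a dvd m} \<le> length (filter (\<lambda>m. p ^ a dvd m) xs)"
      using card_length[of "filter (\<lambda>m. p ^ a dvd m) xs"] by simp
    then have "coverable {m\<in>set xs. \<not> p ^ a dvd m}"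
      using 2 True by (intro coverable_drop_prime_power) auto
    then show ?thesis using True by (simp add: ys_def)
  next
    case False
    then show ?thesis using 2 by (simp add: ys_def)
  qed
  moreover have "set ys \<subseteq> set xs" by (auto simp: ys_def)
  ultimately show ?case using 2 unfolding drop_sparse.simps ys_def[symmetric] by auto
qed simp

lemma not_coverable_of_drop_sparse:
  assumes "0 \<notin> set xs" "\<forall>(p, a)\<in>set ps. prime p \<and> a > 0"
    and "drop_sparse ps xs = ys" "distinct ys" "(\<Sum>m\<leftarrow>ys. 1 / real m) < 1"
  shows "\<not> coverable (set xs)"
proof
  assume "coverable (set xs)"
  from coverable_drop_sparse[OF this assms(1,2)] assms(1,3)
  have "coverable (set ys)" "0 \<notin> set ys" by auto
  then have "1 \<le> (\<Sum>m\<in>set ys. 1 / real m)" by (intro coverable_imp_sum_ge_1) auto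
  also have "\<dots> = (\<Sum>m\<leftarrow>ys. 1 / real m)" using assms(4) by (simp add: sum_list_distinct_conv_sum_set)
  finally show False using assms(5) by simp
qed

lemma not_coverable_interval_exceptional:
  assumes "n \<in> {3, 4, 5, 6, 9}"
  shows "\<not> coverable {n..6 * n}"
proof -
  \<comment> \<open>One schedule serves all five values of \<open>n\<close>. The powers of each
    prime are listed downwards, so that removing multiples of a high power thins out those of a
    lower one.\<close>
  define ps :: "(nat \<times> nat) list" where "ps = map (\<lambda>p. (p, 1)) [53, 47, 43, 41, 37, 31, 29, 23, 19, 17, 13, 11] @
    [(7, 2), (7, 1), (5, 2), (5, 1), (2, 5), (2, 4), (3, 3), (3, 2), (2, 3)]"
  have ps: "\<forall>(p, a)\<in>set ps. prime p \<and> a > 0" by (simp add: ps_def)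
  have upt: "{k..6 * k} = set [k..<6 * k + 1]" for k :: nat by auto
  \<comment> \<open>The explicit lists here and below are the moduli that survive the
    schedule.\<close>
  have "\<not> coverable {3..6 * 3}"
    unfolding upt by (rule not_coverable_of_drop_sparse[OF _ ps, of _ "[3, 4, 6, 12]"]) (simp_all add: ps_def)
  moreover have "\<not> coverable {4..6 * 4}"
    unfolding upt by (rule not_coverable_of_drop_sparse[OF _ ps, of _ "[4, 6, 8, 12, 24]"]) (simp_all add: ps_def)
  moreover have "\<not> coverable {5..6 * 5}"
    unfolding upt by (rule not_coverable_of_drop_sparse[OF _ ps, of _ "[5, 6, 8, 10, 12, 15, 20, 24, 30]"]) (simp_all add: ps_def)
  moreover have "\<not> coverable {6..6 * 6}"
    unfolding upt by (rule not_coverable_of_drop_sparse[OF _ ps, of _ "[6, 8, 9, 12, 18, 24, 36]"]) (simp_all add: ps_def)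
  moreover have "\<not> coverable {9..6 * 9}"
    unfolding upt by (rule not_coverable_of_drop_sparse[OF _ ps, of _ "[9, 10, 12, 15, 16, 18, 20, 24, 30, 36, 40, 45, 48]"])
      (simp_all add: ps_def)
  ultimately show ?thesis using assms by auto
qed

lemma distinct_covering_imp_coverable:
  assumes "distinct_covering C" "snd ` C \<subseteq> M"
  shows "coverable M"
proof -
  \<comment> \<open>Injectivity of \<open>snd\<close> on \<open>C\<close> recovers the residue from
    the modulus. Outside the moduli of \<open>C\<close> the value is unspecified, but only moduli of
    \<open>C\<close> serve as witnesses.\<close>
  define r where "r = (\<lambda>m. fst (the_inv_into C snd m))"
  have "\<exists>m\<in>M. int m dvd x - r m" for x
  proof -
    obtain a m where am: "(a, m) \<in> C" "[x = a] (mod int m)"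
      using assms(1) unfolding distinct_covering_def covering_system_def by blast
    have "the_inv_into C snd (snd (a, m)) = (a, m)"
      using assms(1) am(1) unfolding distinct_covering_def by (intro the_inv_into_f_f) auto
    then have "r m = a" by (simp add: r_def)
    moreover have "m \<in> M" using am(1) assms(2) by force
    ultimately show ?thesis using am(2) by (auto simp: cong_iff_dvd_diff)
  qed
  then show ?thesis unfolding coverable_def by blast
qed

theorem theorem1:
  fixes n :: nat
  assumes "n > 2"
  shows "(\<nexists>C. distinct_covering C \<and> snd ` C \<subseteq> {n..6 * n}) \<and>
         ((\<exists>C. distinct_covering C \<and> snd ` C \<subseteq> {n..}) \<longrightarrow> covering_k n > 6 * n)"
proof (intro conjI impI)
  consider "n \<in> {3, 4, 5, 6, 9}" | "7 \<le> n" "n \<le> 680" "n \<noteq> 9" | "681 \<le> n"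
    using assms by (simp, linarith)
  then have "\<not> coverable {n..6 * n}"
    by cases (rule not_coverable_interval_exceptional not_coverable_interval_le_680
      not_coverable_interval_ge_681; assumption)+
  then show none: "\<nexists>C. distinct_covering C \<and> snd ` C \<subseteq> {n..6 * n}"
    using distinct_covering_imp_coverable by blast
  assume "\<exists>C. distinct_covering C \<and> snd ` C \<subseteq> {n..}"
  then obtain C where C: "distinct_covering C" "snd ` C \<subseteq> {n..}" by blast
  \<comment> \<open>Finitely many moduli are bounded, so some \<open>k\<close> satisfies the
    property under \<open>LEAST\<close>; \<open>Suc\<close> ensures \<open>k > 0\<close>.\<close>
  have "finite (snd ` C)" using C(1) unfolding distinct_covering_def covering_system_def by blast
  then have "m \<le> Suc (Max (snd ` C))" if "m \<in> snd ` C" for m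
    using that by (intro le_SucI Max_ge)
  then have "snd ` C \<subseteq> {n..Suc (Max (snd ` C))}"
    using C(2) by (meson atLeastAtMost_iff atLeast_iff subset_iff)
  with C(1) have "Suc (Max (snd ` C)) > 0 \<and>
      (\<exists>C'. distinct_covering C' \<and> snd ` C' \<subseteq> {n..Suc (Max (snd ` C))})"
    by blast
  then have "covering_k n > 0 \<and> (\<exists>C'. distinct_covering C' \<and> snd ` C' \<subseteq> {n..covering_k n})"
    unfolding covering_k_def by (rule LeastI)
  then obtain C' where C': "distinct_covering C'" "snd ` C' \<subseteq> {n..covering_k n}" by blast
  show "covering_k n > 6 * n"
  proof (rule ccontr)
    assume "\<not> covering_k n > 6 * n"
    then have "{n..covering_k n} \<subseteq> {n..6 * n}" by simp
    then have "snd ` C' \<subseteq> {n..6 * n}" using C'(2) by (rule order_trans[rotated])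
    with none C'(1) show False by blast
  qed
qed

end
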